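(* (A) Let $(X,\sigma_X)$ be an irreducible (one-step) shift of finite type and $\mathcal F=\{\log f_n\}_{n=1}^\infty$ a sequence on $X$ with tempered variation such that $\{\log(e^Cf_n)\}_{n=1}^\infty$ is subadditive for some $C\ge0$. Then $\mathcal F$ is asymptotically additive on $X$ if and only if the following two conditions hold. (i) There exists $h\in C(X)$ such that $\lim_{n\to\infty}\frac1n\log\left(\frac{f_n(x)}{e^{(S_nh)(x)}}\right)=0$ for every periodic point $x\in X$. (ii) There exist $k\in\mathbb N$, $c\ge0$ and a sequence $\{M_n\}_{n=1}^\infty$ of positive real numbers with $\lim_{n\to\infty}\frac1n\log M_n=0$ such that the following holds: for every $0<\epsilon<1$ there exists $N\in\mathbb N$ such that for any $u\in B_n(X)$, $n\ge N$, there exist $0\le q\le k$ and $w\in B_q(X)$ such that $z:=(uw)^\infty$ is a point in $X$ satisfying $$f_{j(n+q)}(z)\ge(M_ne^{-cn\epsilon})^j\left(\sup\{f_n(x):x\in[u]\}\right)^j\quad\text{for every }j\in\mathbb N.$$ (B) Let $(X,\sigma_X)$ be a subshift and $\mathcal F=\{\log f_n\}_{n=1}^\infty$ a sequence on $X$ with tempered variation such that $\{\log(e^Cf_n)\}_{n=1}^\infty$ is subadditive for some $C\ge0$, and suppose $\mathcal F$ satisfies condition (ii) of part (A). Then the following statements are equivalent for $h\in C(X)$. (a) $\mathcal F$ is asymptotically additive on $X$ and satisfies $\lim_{n\to\infty}\frac1n\left\lVert\log\left(\frac{f_n}{e^{S_nh}}\right)\right\rVert_\infty=0$. (b) $\lim_{n\to\infty}\frac1n\int\log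 f_n\,d\mu=\int h\,d\mu>-\infty$ for every $\mu\in M(X,\sigma_X)$. (c) $\lim_{n\to\infty}\frac1n\log\left(\frac{f_n(x)}{e^{(S_nh)(x)}}\right)=0$ for every periodic point $x\in X$. (d) $\lim_{n\to\infty}\frac1n\log\left(\frac{f_n(x)}{e^{(S_nh)(x)}}\right)=0$ for every $x\in X$.
   Context: $\mathbb N=\{1,2,\dots\}$. A (one-sided) subshift $(X,\sigma_X)$ is a closed set $X\subseteq\{1,\dots,k\}^{\mathbb N}$ (some $k\ge1$) with $\sigma_X(X)\subseteq X$, where $(\sigma_Xx)_i=x_{i+1}$. $B_n(X)$ is the set of words of length $n$ appearing in points of $X$, $B_0(X)=\{\epsilon\}$ (empty word), $B(X)=\bigcup_{n\ge0}B_n(X)$. The cylinder $[x_1\dots x_n]$ is the set of $z\in X$ with $z_i=x_i$ for $1\le i\le n$. $X$ is irreducible if for all $u,v\in B(X)$ there is $w\in B(X)$ with $uwv\in B(X)$. Shifts of finite type are one-step: $X$ is the set of all sequences in $\{1,\dots,k\}^{\mathbb N}$ in which no word of a given set of forbidden blocks of length $\le2$ appears. $(uw)^\infty$ is the infinite periodic repetition of the word $uw$. $x$ is periodic if $\sigma_X^lx=x$ for some $l\in\mathbb N$. $M(X,\sigma_X)$ is the set of $\sigma_X$-invariant Borel probability measures. $(S_nh)(x)=\sum_{i=0}^{n-1}h(\sigma_X^ix)$; $\lVert\cdot\rVert_\infty$ is the supremum norm. A sequence $\mathcal F=\{\log f_n\}_{n=1}^\infty$ on $X$ consists of continuous $f_n:X\to(0,\infty)$.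 It is subadditive if $f_{n+m}(x)\le f_n(x)f_m(\sigma_X^nx)$ for all $n,m\in\mathbb N$, $x\in X$. It has tempered variation if $\lim_{n\to\infty}\frac1n\log\sup\{f_n(x)/f_n(y):x,y\in X,\ x_i=y_i\text{ for }1\le i\le n\}=0$. It is asymptotically additive if for every $\epsilon>0$ there is a continuous function $\rho_\epsilon$ on $X$ with $\limsup_{n\to\infty}\frac1n\lVert\log f_n-S_n\rho_\epsilon\rVert_\infty<\epsilon$. *)

theory Defs
  imports "HOL-Probability.Probability"
begin

text \<open>
  Points of \<open>{1,...,k}\<^sup>\<nat>\<close> are functions \<open>nat \<Rightarrow> nat\<close>; the coordinate \<open>x\<^sub>i\<close>
  (\<open>i = 1, 2, ...\<close>) is \<open>x (i - 1)\<close>.  The topology and the Borel sets are those of the product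
  topology on \<open>nat \<Rightarrow> nat\<close> (discrete \<open>nat\<close>).  Since \<open>{1,...,k}\<^sup>\<nat>\<close> is closed there,
  \<open>closed X\<close> agrees with closedness relative to the full shift.  A potential
  \<open>\<F> = {log f\<^sub>n}\<close> is given by \<open>f\<close>, of which only the values \<open>f n x\<close> with \<open>n \<ge> 1\<close> and
  \<open>x \<in> X\<close> matter.
\<close>

definition shift_map :: "(nat \<Rightarrow> nat) \<Rightarrow> (nat \<Rightarrow> nat)" where
  "shift_map x = (\<lambda>i. x (Suc i))"

definition full_shift :: "nat \<Rightarrow> (nat \<Rightarrow> nat) set" where
  "full_shift k = {x. \<forall>i. x i \<in> {1..k}}"

definition is_subshift :: "(nat \<Rightarrow> nat) set \<Rightarrow> bool" where
  "is_subshift X \<longleftrightarrow> (\<exists>k\<ge>1. X \<subseteq> full_shift k) \<and> closed X \<and> shift_map ` X \<subseteq> X"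

definition appears_in :: "nat list \<Rightarrow> (nat \<Rightarrow> nat) \<Rightarrow> bool" where
  "appears_in u x \<longleftrightarrow> (\<exists>i. \<forall>j<length u. x (i + j) = u ! j)"

text \<open>The case distinction only matters for \<open>X = {}\<close>, where \<open>B\<^sub>0(X)\<close> is still \<open>{\<epsilon>}\<close>.\<close>

definition words_of_length :: "nat \<Rightarrow> (nat \<Rightarrow> nat) set \<Rightarrow> nat list set" where
  "words_of_length n X =
    (if n = 0 then {[]} else {u. length u = n \<and> (\<exists>x\<in>X. appears_in u x)})"

definition all_words :: "(nat \<Rightarrow> nat) set \<Rightarrow> nat list set" where
  "all_words X = (\<Union>n. words_of_length n X)"

definition cylinder :: "(nat \<Rightarrow> nat) set \<Rightarrow> nat list \<Rightarrow> (nat \<Rightarrow> nat) set" where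
  "cylinder X u = {z\<in>X. \<forall>i<length u. z i = u ! i}"

definition irreducible_shift :: "(nat \<Rightarrow> nat) set \<Rightarrow> bool" where
  "irreducible_shift X \<longleftrightarrow>
    (\<forall>u\<in>all_words X. \<forall>v\<in>all_words X. \<exists>w\<in>all_words X. u @ w @ v \<in> all_words X)"

definition one_step_SFT :: "(nat \<Rightarrow> nat) set \<Rightarrow> bool" where
  "one_step_SFT X \<longleftrightarrow>
    (\<exists>k\<ge>1. \<exists>F. F \<subseteq> {u \<in> lists {1..k}. length u \<le> 2} \<and>
      X = {x \<in> full_shift k. \<forall>u\<in>F. \<not> appears_in u x})"

definition periodic_word :: "nat list \<Rightarrow> (nat \<Rightarrow> nat)" where
  "periodic_word v = (\<lambda>i. v ! (i mod length v))"

definition periodic_point :: "(nat \<Rightarrow> nat) \<Rightarrow> bool" where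
  "periodic_point x \<longleftrightarrow> (\<exists>l\<ge>1. (shift_map ^^ l) x = x)"

definition invariant_measures :: "(nat \<Rightarrow> nat) set \<Rightarrow> (nat \<Rightarrow> nat) measure set" where
  "invariant_measures X =
    {\<mu>. prob_space \<mu> \<and> sets \<mu> = sets (restrict_space borel X) \<and>
         distr \<mu> \<mu> shift_map = \<mu>}"

definition birkhoff_sum :: "nat \<Rightarrow> ((nat \<Rightarrow> nat) \<Rightarrow> real) \<Rightarrow> (nat \<Rightarrow> nat) \<Rightarrow> real" where
  "birkhoff_sum n h x = (\<Sum>i<n. h ((shift_map ^^ i) x))"

text \<open>For the functions it is applied to (continuous on the compact set \<open>X\<close>) this is a genuine
  supremum, unless \<open>X = {}\<close>.\<close>

definition sup_norm :: "(nat \<Rightarrow> nat) set \<Rightarrow> ((nat \<Rightarrow> nat) \<Rightarrow> real) \<Rightarrow> real" where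
  "sup_norm X g = (SUP x\<in>X. \<bar>g x\<bar>)"

definition potential_seq ::
    "(nat \<Rightarrow> nat) set \<Rightarrow> (nat \<Rightarrow> (nat \<Rightarrow> nat) \<Rightarrow> real) \<Rightarrow> bool" where
  "potential_seq X f \<longleftrightarrow> (\<forall>n\<ge>1. continuous_on X (f n) \<and> (\<forall>x\<in>X. 0 < f n x))"

definition subadditive_seq ::
    "(nat \<Rightarrow> nat) set \<Rightarrow> (nat \<Rightarrow> (nat \<Rightarrow> nat) \<Rightarrow> real) \<Rightarrow> bool" where
  "subadditive_seq X f \<longleftrightarrow>
    (\<forall>n\<ge>1. \<forall>m\<ge>1. \<forall>x\<in>X. f (n + m) x \<le> f n x * f m ((shift_map ^^ n) x))"

definition tempered_variation ::
    "(nat \<Rightarrow> nat) set \<Rightarrow> (nat \<Rightarrow> (nat \<Rightarrow> nat) \<Rightarrow> real) \<Rightarrow> bool" where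
  "tempered_variation X f \<longleftrightarrow>
    (\<lambda>n. 1 / real n *
          ln (Sup {f n x / f n y | x y. x \<in> X \<and> y \<in> X \<and> (\<forall>i<n. x i = y i)}))
      \<longlonglongrightarrow> 0"

definition asymptotically_additive ::
    "(nat \<Rightarrow> nat) set \<Rightarrow> (nat \<Rightarrow> (nat \<Rightarrow> nat) \<Rightarrow> real) \<Rightarrow> bool" where
  "asymptotically_additive X f \<longleftrightarrow>
    (\<forall>\<epsilon>>0. \<exists>\<rho>. continuous_on X \<rho> \<and>
      limsup (\<lambda>n. ereal (1 / real n * sup_norm X (\<lambda>x. ln (f n x) - birkhoff_sum n \<rho> x)))
        < ereal \<epsilon>)"

definition periodic_lower_bound ::
    "(nat \<Rightarrow> nat) set \<Rightarrow> (nat \<Rightarrow> (nat \<Rightarrow> nat) \<Rightarrow> real) \<Rightarrow> bool" where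
  "periodic_lower_bound X f \<longleftrightarrow>
    (\<exists>k\<ge>(1::nat). \<exists>c\<ge>(0::real). \<exists>M::nat \<Rightarrow> real.
      (\<forall>n\<ge>1. 0 < M n) \<and> (\<lambda>n. 1 / real n * ln (M n)) \<longlonglongrightarrow> 0 \<and>
      (\<forall>\<epsilon>. 0 < \<epsilon> \<and> \<epsilon> < 1 \<longrightarrow>
        (\<exists>N\<ge>1. \<forall>n\<ge>N. \<forall>u\<in>words_of_length n X.
          \<exists>q\<le>k. \<exists>w\<in>words_of_length q X.
            periodic_word (u @ w) \<in> X \<and>
            (\<forall>j\<ge>1. f (j * (n + q)) (periodic_word (u @ w))
               \<ge> (M n * exp (- c * real n * \<epsilon>)) ^ j * (SUP x\<in>cylinder X u. f n x) ^ j))))"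

text \<open>The limit \<open>lim\<^sub>n 1/n log (f\<^sub>n(x) / e\<^bsup>(S\<^sub>n h)(x)\<^esup>) = 0\<close> at the point \<open>x\<close>.\<close>

definition birkhoff_asymptotic_at ::
    "(nat \<Rightarrow> (nat \<Rightarrow> nat) \<Rightarrow> real) \<Rightarrow> ((nat \<Rightarrow> nat) \<Rightarrow> real) \<Rightarrow> (nat \<Rightarrow> nat) \<Rightarrow> bool" where
  "birkhoff_asymptotic_at f h x \<longleftrightarrow>
    (\<lambda>n. 1 / real n * ln (f n x / exp (birkhoff_sum n h x))) \<longlonglongrightarrow> 0"

definition birkhoff_asymptotic_uniformly ::
    "(nat \<Rightarrow> nat) set \<Rightarrow> (nat \<Rightarrow> (nat \<Rightarrow> nat) \<Rightarrow> real) \<Rightarrow> ((nat \<Rightarrow> nat) \<Rightarrow> real) \<Rightarrow> bool" where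
  "birkhoff_asymptotic_uniformly X f h \<longleftrightarrow>
    (\<lambda>n. 1 / real n * sup_norm X (\<lambda>x. ln (f n x / exp (birkhoff_sum n h x)))) \<longlonglongrightarrow> 0"

text \<open>Both integrands are bounded and measurable on \<open>X\<close>, so the Bochner integrals are the
  usual ones; the strict inequality is kept as in the source, in the extended reals.\<close>

definition same_asymptotic_integrals ::
    "(nat \<Rightarrow> nat) set \<Rightarrow> (nat \<Rightarrow> (nat \<Rightarrow> nat) \<Rightarrow> real) \<Rightarrow> ((nat \<Rightarrow> nat) \<Rightarrow> real) \<Rightarrow> bool" where
  "same_asymptotic_integrals X f h \<longleftrightarrow>
    (\<forall>\<mu>\<in>invariant_measures X.
      (\<lambda>n. ereal (1 / real n * (\<integral>x. ln (f n x) \<partial>\<mu>))) \<longlonglongrightarrow> ereal (\<integral>x. h x \<partial>\<mu>) \<and>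
      ereal (\<integral>x. h x \<partial>\<mu>) > - \<infinity>)"

end

theory Submission
  imports Defs
begin

text \<open>
  Everything is compared with uniform growth: \<open>\<bar>ln f\<^sub>n - S\<^sub>n h\<bar> \<le> \<epsilon> n\<close> on \<open>X\<close> for all large
  \<open>n\<close>.  The crucial implication goes from periodic points to uniform growth.  A word \<open>u\<close> of length
  \<open>n\<close> is closed up to a point \<open>z = (uw)\<^sup>\<infinity>\<close> of period \<open>p = n + q\<close> with \<open>q\<close> bounded, where
  \<open>S\<^sub>p h(z) = lim\<^sub>j ln f\<^sub>j\<^sub>p(z) / j\<close>; condition (ii) bounds the limit from below by \<open>ln f\<^sub>n\<close> on
  \<open>[u]\<close>, and subadditivity bounds it from above by \<open>ln f\<^sub>p(z) + C\<close>, hence by \<open>ln f\<^sub>n(z)\<close> up to a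
  constant.  Tempered variation and the uniform continuity of \<open>h\<close> carry this to all of \<open>[u]\<close>.
  Invariant measures enter only through those carried by periodic orbits.  Conversely, for an
  asymptotically additive sequence a theorem of Cuneo yields a single \<open>h\<close> with uniform growth,
  and in an irreducible shift of finite type words can be closed up by connecting words of bounded
  length.
\<close>

section \<open>Birkhoff sums\<close>

lemma shift_map_funpow: "(shift_map ^^ n) x = (\<lambda>i. x (i + n))"
  by (induction n) (simp_all add: shift_map_def fun_eq_iff)

lemma continuous_on_shift_map_funpow: "continuous_on A (shift_map ^^ n)"
proof -
  have "continuous_on UNIV (\<lambda>x i. x (i + n) :: nat)"
    by (intro continuous_on_coordinatewise_then_product continuous_on_product_coordinates)
  moreover have "shift_map ^^ n = (\<lambda>x i. x (i + n))"
    by (simp add: fun_eq_iff shift_map_funpow)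
  ultimately show ?thesis
    using continuous_on_subset by fastforce
qed

text \<open>Tychonoff's theorem for a finite alphabet.\<close>

lemma compact_full_shift: "compact (full_shift k)"
proof -
  have "full_shift k = PiE UNIV (\<lambda>_. {1..k})"
    by (auto simp: full_shift_def PiE_def Pi_def)
  moreover have "compactin (product_topology (\<lambda>_. euclidean) UNIV) (PiE UNIV (\<lambda>_. {1..k::nat}))"
    unfolding compactin_PiE by (auto simp: finite_imp_compact)
  ultimately show ?thesis
    by (simp add: euclidean_product_topology)
qed

lemma birkhoff_sum_add:
  "birkhoff_sum (m + n) h x = birkhoff_sum m h x + birkhoff_sum n h ((shift_map ^^ m) x)"
  unfolding birkhoff_sum_def
  by (subst add.commute, induction n) (simp_all add: funpow_add add.commute shift_map_funpow add.left_commute)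

lemma birkhoff_sum_fun_diff:
  "birkhoff_sum n (\<lambda>x. g x - h x) x = birkhoff_sum n g x - birkhoff_sum n h x"
  by (simp add: birkhoff_sum_def sum_subtractf)

lemma birkhoff_sum_shift:
  "birkhoff_sum n h (shift_map x) = birkhoff_sum n h x - h x + h ((shift_map ^^ n) x)"
  using birkhoff_sum_add[of 1 n h x] birkhoff_sum_add[of n 1 h x]
  by (simp add: birkhoff_sum_def)

lemma funpow_mult_fixed: "(f ^^ p) z = z \<Longrightarrow> (f ^^ (j * p)) z = z"
  by (induction j) (simp_all add: funpow_add)

lemma birkhoff_sum_periodic:
  assumes "(shift_map ^^ p) z = z"
  shows "birkhoff_sum (j * p) h z = real j * birkhoff_sum p h z"
proof (induction j)
  case 0
  show ?case by (simp add: birkhoff_sum_def)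
next
  case (Suc j)
  then show ?case
    by (simp add: birkhoff_sum_add assms ring_distribs)
qed

lemma periodic_word_period: "(shift_map ^^ length v) (periodic_word v) = periodic_word v"
  by (simp add: shift_map_funpow periodic_word_def)

lemma periodic_word_prefix: "i < length u \<Longrightarrow> periodic_word (u @ w) i = u ! i"
  by (simp add: periodic_word_def nth_append)

section \<open>Means \<open>a n / n\<close> and linear error bounds\<close>

lemma tendsto_const_over_n: "(\<lambda>n. 1 / real n * c) \<longlonglongrightarrow> 0"
  using lim_const_over_n[of c] by simp

lemma eventually_const_le_mult:
  assumes "0 < \<epsilon>"
  shows "\<forall>\<^sub>F n in sequentially. c \<le> \<epsilon> * real n"
proof -
  have "\<forall>\<^sub>F n in sequentially. n \<ge> nat \<lceil>c / \<epsilon>\<rceil>"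
    by (rule eventually_ge_at_top)
  then show ?thesis
    by eventually_elim (use assms in \<open>simp add: nat_ceiling_le_eq field_simps\<close>)
qed

text \<open>Together with its converse below, this trades limits of means for bounds linear in
  \<open>n\<close>, which can be added up and can be made uniform in a point of
  \<open>X\<close>.\<close>

lemma tendsto_zero_imp_eventually_le:
  fixes a :: "nat \<Rightarrow> real"
  assumes "(\<lambda>n. 1 / real n * a n) \<longlonglongrightarrow> 0" and "0 < \<epsilon>"
  shows "\<forall>\<^sub>F n in sequentially. \<bar>a n\<bar> \<le> \<epsilon> * real n"
proof -
  have "\<forall>\<^sub>F n in sequentially. \<bar>1 / real n * a n\<bar> < \<epsilon>"
    using assms by (simp add: tendsto_iff dist_real_def)
  then show ?thesis
    using eventually_gt_at_top[of 0]
    by eventually_elim (auto simp: field_simps abs_mult)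
qed

lemma eventually_le_imp_tendsto_zero:
  fixes a :: "nat \<Rightarrow> real"
  assumes "\<And>\<epsilon>. 0 < \<epsilon> \<Longrightarrow> \<forall>\<^sub>F n in sequentially. \<bar>a n\<bar> \<le> \<epsilon> * real n"
  shows "(\<lambda>n. 1 / real n * a n) \<longlonglongrightarrow> 0"
proof (rule tendstoI)
  fix \<epsilon> :: real assume "0 < \<epsilon>"
  then have "\<forall>\<^sub>F n in sequentially. \<bar>a n\<bar> \<le> \<epsilon> / 2 * real n"
    by (intro assms) simp
  then show "\<forall>\<^sub>F n in sequentially. dist (1 / real n * a n) 0 < \<epsilon>"
    using eventually_gt_at_top[of 0]
  proof eventually_elim
    case (elim n)
    then have "\<bar>a n\<bar> < \<epsilon> * real n"
      using mult_strict_right_mono[of "\<epsilon> / 2" \<epsilon> "real n"] \<open>0 < \<epsilon>\<close> by linarith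
    then show ?case
      using elim(2) by (simp add: dist_real_def abs_mult field_simps)
  qed
qed

lemma tendsto_mean_diff_iff:
  fixes a :: "nat \<Rightarrow> real"
  shows "(\<lambda>n. 1 / real n * (a n - real n * c)) \<longlonglongrightarrow> 0 \<longleftrightarrow> (\<lambda>n. 1 / real n * a n) \<longlonglongrightarrow> c"
proof -
  have "(\<lambda>n. 1 / real n * (a n - real n * c)) \<longlonglongrightarrow> 0 \<longleftrightarrow> (\<lambda>n. 1 / real n * a n - c) \<longlonglongrightarrow> 0"
    by (intro filterlim_cong refl eventually_mono[OF eventually_ge_at_top[of 1]])
       (simp add: field_simps)
  then show ?thesis by (simp only: LIM_zero_iff)
qed

text \<open>The bound is pointwise instead of through \<open>sup_norm\<close>, so it is meaningful
  for unbounded functions and for empty \<open>X\<close>. One \<open>\<epsilon>\<close> is what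
  asymptotic additivity provides for one approximating potential; all \<open>\<epsilon>\<close>
  together express uniform growth.\<close>

definition growth_within ::
    "(nat \<Rightarrow> nat) set \<Rightarrow> (nat \<Rightarrow> (nat \<Rightarrow> nat) \<Rightarrow> real) \<Rightarrow> ((nat \<Rightarrow> nat) \<Rightarrow> real) \<Rightarrow> real \<Rightarrow> bool" where
  "growth_within X f \<rho> \<epsilon> \<longleftrightarrow>
    (\<forall>\<^sub>F n in sequentially. \<forall>x\<in>X. \<bar>ln (f n x) - birkhoff_sum n \<rho> x\<bar> \<le> \<epsilon> * real n)"

section \<open>Compactness, sup norms and dependence on coordinates\<close>

locale subshift =
  fixes X :: "(nat \<Rightarrow> nat) set"
  assumes is_subshift: "is_subshift X"
begin

lemma compact: "compact X"
proof -
  obtain k where "X \<subseteq> full_shift k" "closed X"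
    using is_subshift by (auto simp: is_subshift_def)
  then show ?thesis
    using compact_Int_closed[OF compact_full_shift] by (metis inf.absorb2)
qed

lemma shift_closed: "x \<in> X \<Longrightarrow> shift_map x \<in> X"
  using is_subshift by (auto simp: is_subshift_def)

lemma funpow_shift_closed: "x \<in> X \<Longrightarrow> (shift_map ^^ n) x \<in> X"
  by (induction n) (auto intro: shift_closed)

lemma bounded_abs:
  assumes "continuous_on X g"
  obtains B :: real where "0 \<le> B" "\<And>x. x \<in> X \<Longrightarrow> \<bar>g x\<bar> \<le> B"
proof -
  have "bounded (g ` X)"
    by (intro compact_imp_bounded compact_continuous_image assms compact)
  then obtain B where "\<And>x. x \<in> X \<Longrightarrow> \<bar>g x\<bar> \<le> B"
    by (auto simp: bounded_iff)
  then show thesis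
    by (intro that[of "\<bar>B\<bar>"]) force+
qed

lemma continuous_on_comp_shift:
  assumes "continuous_on X g"
  shows "continuous_on X (\<lambda>x. g ((shift_map ^^ n) x))"
  by (rule continuous_on_compose2[OF assms continuous_on_shift_map_funpow])
     (auto intro: funpow_shift_closed)

lemma continuous_on_birkhoff_sum [continuous_intros]:
  "continuous_on X g \<Longrightarrow> continuous_on X (birkhoff_sum n g)"
  unfolding birkhoff_sum_def by (intro continuous_on_sum continuous_on_comp_shift)

lemma abs_birkhoff_sum_le:
  assumes "\<And>x. x \<in> X \<Longrightarrow> \<bar>g x\<bar> \<le> B" and "x \<in> X"
  shows "\<bar>birkhoff_sum n g x\<bar> \<le> B * real n"
proof -
  have "\<bar>birkhoff_sum n g x\<bar> \<le> (\<Sum>i<n. B)"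
    unfolding birkhoff_sum_def
    by (intro order_trans[OF sum_abs] sum_mono assms funpow_shift_closed)
  then show ?thesis by (simp add: mult.commute)
qed

lemma sup_norm_upper:
  "continuous_on X g \<Longrightarrow> x \<in> X \<Longrightarrow> \<bar>g x\<bar> \<le> sup_norm X g"
  unfolding sup_norm_def
  by (rule cSUP_upper) (auto intro: bounded_abs[of g] simp: bdd_above_def)

lemma sup_norm_tendsto_iff:
  assumes "\<And>n. 1 \<le> n \<Longrightarrow> continuous_on X (g n)"
  shows "(\<lambda>n. 1 / real n * sup_norm X (g n)) \<longlonglongrightarrow> 0 \<longleftrightarrow>
    (\<forall>\<epsilon>>0. \<forall>\<^sub>F n in sequentially. \<forall>x\<in>X. \<bar>g n x\<bar> \<le> \<epsilon> * real n)"
proof (intro iffI allI impI)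
  fix \<epsilon> :: real
  assume "(\<lambda>n. 1 / real n * sup_norm X (g n)) \<longlonglongrightarrow> 0" "0 < \<epsilon>"
  then have "\<forall>\<^sub>F n in sequentially. \<bar>sup_norm X (g n)\<bar> \<le> \<epsilon> * real n"
    by (rule tendsto_zero_imp_eventually_le)
  then show "\<forall>\<^sub>F n in sequentially. \<forall>x\<in>X. \<bar>g n x\<bar> \<le> \<epsilon> * real n"
    using eventually_ge_at_top[of 1]
    by eventually_elim (use sup_norm_upper assms in fastforce)
next
  assume *: "\<forall>\<epsilon>>0. \<forall>\<^sub>F n in sequentially. \<forall>x\<in>X. \<bar>g n x\<bar> \<le> \<epsilon> * real n"
  show "(\<lambda>n. 1 / real n * sup_norm X (g n)) \<longlonglongrightarrow> 0"
  proof (cases "X = {}")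
    \<comment> \<open>For empty \<open>X\<close> the norm is the constant \<open>Sup {}\<close>, the
      same for every \<open>n\<close>, so its mean still tends to 0.\<close>
    case True
    then show ?thesis
      unfolding sup_norm_def by (simp only: image_empty tendsto_const_over_n)
  next
    case False
    then obtain x0 where "x0 \<in> X" by blast
    show ?thesis
    proof (rule eventually_le_imp_tendsto_zero)
      fix \<epsilon> :: real assume "0 < \<epsilon>"
      with * have "\<forall>\<^sub>F n in sequentially. \<forall>x\<in>X. \<bar>g n x\<bar> \<le> \<epsilon> * real n"
        by blast
      then show "\<forall>\<^sub>F n in sequentially. \<bar>sup_norm X (g n)\<bar> \<le> \<epsilon> * real n"
        using eventually_ge_at_top[of 1]
      proof eventually_elim
        case (elim n)
        then have "sup_norm X (g n) \<le> \<epsilon> * real n"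
          unfolding sup_norm_def using False by (intro cSUP_least) auto
        moreover have "0 \<le> sup_norm X (g n)"
          using sup_norm_upper[OF assms \<open>x0 \<in> X\<close>, of n] elim by linarith
        ultimately show ?case by simp
      qed
    qed
  qed
qed

text \<open>A basic neighbourhood in the product topology restricts only finitely many coordinates,
  hence contains every point that agrees with \<open>x\<close> up to the last restricted
  one.\<close>

lemma continuous_coordinates:
  assumes "continuous_on X h" and "x \<in> X" and "0 < \<epsilon>"
  obtains m where "\<And>y. \<lbrakk>y \<in> X; \<And>i. i < m \<Longrightarrow> y i = x i\<rbrakk> \<Longrightarrow> \<bar>h y - h x :: real\<bar> < \<epsilon>"
proof -
  obtain U where U: "open U" "x \<in> U" "\<And>y. y \<in> X \<Longrightarrow> y \<in> U \<Longrightarrow> h y \<in> ball (h x) \<epsilon>"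
    using assms(1)[unfolded continuous_on_topological, rule_format, OF assms(2) open_ball, of "h x" \<epsilon>]
      assms(3) by auto
  have "openin (product_topology (\<lambda>_. euclidean) UNIV) U"
    using \<open>open U\<close> by (simp add: euclidean_product_topology)
  then obtain V where V: "x \<in> PiE UNIV V" "finite {i. V i \<noteq> UNIV}" "PiE UNIV V \<subseteq> U"
    using product_topology_open_contains_basis[of "\<lambda>_. euclidean" UNIV U x] \<open>x \<in> U\<close>
    by (auto simp only: topspace_euclidean)
  show thesis
  proof
    \<comment> \<open>The witness is one more than the last restricted coordinate. If none is
      restricted, the maximum is over the empty set and its value is irrelevant.\<close>
    fix y assume y: "y \<in> X" "\<And>i. i < Suc (Max {i. V i \<noteq> UNIV}) \<Longrightarrow> y i = x i"
    have "y i \<in> V i" for i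
    proof (cases "V i = UNIV")
      case False
      then have "i \<le> Max {i. V i \<noteq> UNIV}"
        using V(2) by (intro Max_ge) auto
      then show ?thesis
        using y(2)[of i] V(1) by (auto simp: PiE_def Pi_def)
    qed simp
    then have "y \<in> U" using V(3) by (auto simp: PiE_def Pi_def)
    then show "\<bar>h y - h x\<bar> < \<epsilon>"
      using U(3)[OF y(1)] by (simp add: dist_real_def abs_minus_commute)
  qed
qed

text \<open>Compactness makes the length uniform: finitely many cylinders on which \<open>h\<close>
  stays within \<open>\<epsilon> / 2\<close> of its value at the centre cover \<open>X\<close>, and
  the longest of them decides.\<close>

lemma uniform_coordinates:
  assumes "continuous_on X h" and "0 < \<epsilon>"
  obtains m where
    "\<And>x y. \<lbrakk>x \<in> X; y \<in> X; \<And>i. i < m \<Longrightarrow> x i = y i\<rbrakk> \<Longrightarrow> \<bar>h x - h y :: real\<bar> < \<epsilon>"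
proof -
  have "\<exists>m. \<forall>y\<in>X. (\<forall>i<m. y i = x i) \<longrightarrow> \<bar>h y - h x\<bar> < \<epsilon> / 2" if "x \<in> X" for x
    using continuous_coordinates[OF assms(1) that, of "\<epsilon> / 2"] assms(2)
    by (metis half_gt_zero)
  then obtain m where m:
    "\<And>x y. \<lbrakk>x \<in> X; y \<in> X; \<And>i. i < m x \<Longrightarrow> y i = x i\<rbrakk> \<Longrightarrow> \<bar>h y - h x\<bar> < \<epsilon> / 2"
    by metis
  have "open {y. \<forall>i\<in>{..<m x}. y i \<in> {x i}}" for x
    by (rule product_topology_basis'[of _ _ "\<lambda>i. i"]) (auto intro: discrete_topology_class.open_discrete)
  then obtain D where D: "D \<subseteq> X" "finite D" "X \<subseteq> (\<Union>x\<in>D. {y. \<forall>i\<in>{..<m x}. y i \<in> {x i}})"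
    by (rule compactE_image[OF compact, of X]) auto
  show thesis
  proof
    fix x y assume *: "x \<in> X" "y \<in> X" "\<And>i. i < Max (m ` D) \<Longrightarrow> x i = y i"
    from D(3) *(1) obtain z where z: "z \<in> D" "\<And>i. i < m z \<Longrightarrow> x i = z i" by auto
    have "m z \<le> Max (m ` D)" using z(1) D(2) by (intro Max_ge) auto
    then have "\<And>i. i < m z \<Longrightarrow> y i = z i" using z(2) *(3) by force
    moreover have "z \<in> X" using z(1) D(1) by blast
    ultimately have "\<bar>h x - h z\<bar> < \<epsilon> / 2" "\<bar>h y - h z\<bar> < \<epsilon> / 2"
      using m z(2) *(1,2) by blast+
    then show "\<bar>h x - h y\<bar> < \<epsilon>" by linarith
  qed
qed

text \<open>If \<open>x\<close> and \<open>y\<close> agree on \<open>n\<close> coordinates, their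
  first \<open>n - m\<close> shifts still agree on \<open>m\<close> coordinates, so these terms
  differ by less than \<open>\<epsilon> / 2\<close> each. The last \<open>m\<close> terms are
  controlled only by the bound \<open>B\<close>, but their number is fixed.\<close>

lemma birkhoff_sum_variation:
  assumes "continuous_on X h" and "0 < \<epsilon>"
  shows "\<forall>\<^sub>F n in sequentially. \<forall>x\<in>X. \<forall>y\<in>X. (\<forall>i<n. x i = y i) \<longrightarrow>
    \<bar>birkhoff_sum n h x - birkhoff_sum n h y\<bar> \<le> \<epsilon> * real n"
proof -
  obtain B where "0 \<le> B" and B: "\<And>x. x \<in> X \<Longrightarrow> \<bar>h x\<bar> \<le> B"
    using bounded_abs[OF assms(1)] by blast
  obtain m where m: "\<And>x y. \<lbrakk>x \<in> X; y \<in> X; \<And>i. i < m \<Longrightarrow> x i = y i\<rbrakk> \<Longrightarrow> \<bar>h x - h y\<bar> < \<epsilon> / 2"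
    using uniform_coordinates[OF assms(1), of "\<epsilon> / 2"] assms(2) by auto
  have "\<forall>\<^sub>F n in sequentially. 2 * B * real m \<le> \<epsilon> / 2 * real n"
    using assms(2) by (intro eventually_const_le_mult) simp
  then show ?thesis
    using eventually_ge_at_top[of m]
  proof (eventually_elim, intro ballI impI)
    fix n x y
    assume n: "2 * B * real m \<le> \<epsilon> / 2 * real n" "m \<le> n"
      and xy: "x \<in> X" "y \<in> X" "\<forall>i<n. x i = y i"
    define l where "l = n - m"
    have l: "n = l + m" using n by (simp add: l_def)
    have "\<bar>birkhoff_sum l h x - birkhoff_sum l h y\<bar> \<le> (\<Sum>i<l. \<epsilon> / 2)"
      unfolding birkhoff_sum_def sum_subtractf[symmetric]
    proof (intro order_trans[OF sum_abs] sum_mono less_imp_le m funpow_shift_closed xy)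
      fix i j assume "i \<in> {..<l}" "j < m"
      then show "(shift_map ^^ i) x j = (shift_map ^^ i) y j"
        using xy(3) l by (simp add: shift_map_funpow)
    qed
    moreover have "\<bar>birkhoff_sum m h ((shift_map ^^ l) z)\<bar> \<le> B * real m" if "z \<in> X" for z
      by (rule abs_birkhoff_sum_le[OF B]) (auto intro: funpow_shift_closed that)
    from this[OF xy(1)] this[OF xy(2)]
    have "\<bar>birkhoff_sum m h ((shift_map ^^ l) x) - birkhoff_sum m h ((shift_map ^^ l) y)\<bar>
        \<le> 2 * B * real m"
      by linarith
    moreover have "(\<Sum>i<l. \<epsilon> / 2) \<le> \<epsilon> / 2 * real n"
      using assms(2) l by (simp add: algebra_simps)
    ultimately have "\<bar>birkhoff_sum l h x - birkhoff_sum l h y\<bar> \<le> \<epsilon> / 2 * real n"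
      and "\<bar>birkhoff_sum m h ((shift_map ^^ l) x) - birkhoff_sum m h ((shift_map ^^ l) y)\<bar>
        \<le> \<epsilon> / 2 * real n"
      using n(1) by linarith+
    then show "\<bar>birkhoff_sum n h x - birkhoff_sum n h y\<bar> \<le> \<epsilon> * real n"
      using birkhoff_sum_add[of l m h x, folded l] birkhoff_sum_add[of l m h y, folded l]
      by linarith
  qed
qed

text \<open>An occurrence at position \<open>i\<close> becomes a prefix after \<open>i\<close>
  shifts. Length 0 is excluded because the empty word belongs even to an empty
  \<open>X\<close>.\<close>

lemma words_of_lengthE:
  assumes "u \<in> words_of_length n X" and "1 \<le> n"
  obtains x where "x \<in> X" "length u = n" "x \<in> cylinder X u"
proof -
  from assms obtain x i where xi: "x \<in> X" "length u = n" "\<forall>j<length u. x (i + j) = u ! j"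
    by (auto simp: words_of_length_def appears_in_def split: if_splits)
  then show thesis
    by (intro that[of "(shift_map ^^ i) x"])
       (auto simp: cylinder_def funpow_shift_closed, simp add: shift_map_funpow add.commute)
qed

end

text \<open>The occurrence of a fixed word is an open condition, a union over positions of finitely
  many coordinate conditions, so forbidding it is closed. An occurrence in the shifted point is an
  occurrence one place later in the point itself.\<close>

lemma one_step_SFT_imp_is_subshift:
  assumes "one_step_SFT X"
  shows "is_subshift X"
proof -
  obtain k F where k: "k \<ge> 1" and X: "X = {x \<in> full_shift k. \<forall>u\<in>F. \<not> appears_in u x}"
    using assms by (auto simp: one_step_SFT_def)
  have "open {x. x (i::nat) = (a::nat)}" for i a
  proof -
    have "open ((\<lambda>x::nat\<Rightarrow>nat. x i) -` {a})"
      by (intro open_vimage discrete_topology_class.open_discrete continuous_on_product_coordinates)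
    then show ?thesis by (simp add: vimage_def)
  qed
  then have "open {x. appears_in u x}" for u
  proof -
    have "{x. appears_in u x} = (\<Union>i. \<Inter>j\<in>{..<length u}. {x. x (i + j) = u ! j})"
      by (auto simp: appears_in_def)
    then show ?thesis
      using \<open>\<And>i a. open {x. x i = a}\<close> by (simp add: open_UN open_INT)
  qed
  then have "closed (- {x. appears_in u x})" for u by blast
  moreover have "X = full_shift k \<inter> (\<Inter>u\<in>F. - {x. appears_in u x})"
    unfolding X by auto
  moreover have "closed ((\<lambda>x::nat\<Rightarrow>nat. x i) -` {1..k})" for i
    by (intro closed_vimage closed_atLeastAtMost continuous_on_product_coordinates)
  then have "closed (\<Inter>i. (\<lambda>x::nat\<Rightarrow>nat. x i) -` {1..k})"
    by blast
  moreover have "full_shift k = (\<Inter>i. (\<lambda>x. x i) -` {1..k})"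
    by (auto simp: full_shift_def)
  ultimately have "closed X"
    by (simp add: closed_Int closed_INT)
  moreover have "appears_in u x" if "appears_in u (shift_map x)" for u x
    using that unfolding appears_in_def shift_map_def by (metis add_Suc)
  then have "shift_map ` X \<subseteq> X"
    unfolding X by (auto simp: full_shift_def shift_map_def)
  ultimately show ?thesis
    using k X by (auto simp: is_subshift_def)
qed

context subshift
begin

section \<open>Coboundaries and Cuneo's theorem\<close>

text \<open>The time average of \<open>g\<close> differs from \<open>g\<close> by the coboundary of
  \<open>(\<Sum>k<N. S\<^sub>k g) / N\<close>, which does not affect growth rates.\<close>

lemma birkhoff_sum_average:
  assumes "continuous_on X g" and "1 \<le> N"
  obtains D where "\<And>n x. x \<in> X \<Longrightarrow>
    \<bar>birkhoff_sum n (\<lambda>y. birkhoff_sum N g y / real N) x - birkhoff_sum n g x\<bar> \<le> D"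
proof -
  define v where "v = (\<lambda>x. (\<Sum>k<N. birkhoff_sum k g x) / real N)"
  \<comment> \<open>Shifting turns \<open>S_k g\<close> into \<open>S_k g - g\<close> plus
    \<open>g\<close> after \<open>k\<close> shifts, and summing the last terms over
    \<open>k < N\<close> gives \<open>S_N g\<close>. Hence the average minus \<open>g\<close> is
    \<open>v\<close> after the shift minus \<open>v\<close>, and Birkhoff sums of it telescope to
    two values of the bounded function \<open>v\<close>.\<close>
  have v_shift: "v (shift_map x) = v x - g x + birkhoff_sum N g x / real N" for x
  proof -
    have "(\<Sum>k<N. birkhoff_sum k g (shift_map x))
        = (\<Sum>k<N. birkhoff_sum k g x) - real N * g x + birkhoff_sum N g x"
      by (simp add: birkhoff_sum_shift sum.distrib sum_subtractf)
         (simp add: birkhoff_sum_def)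
    then show ?thesis
      using assms(2) by (simp add: v_def divide_simps)
  qed
  have "birkhoff_sum n (\<lambda>y. birkhoff_sum N g y / real N) x - birkhoff_sum n g x
      = v ((shift_map ^^ n) x) - v x" for n x
  proof (induction n)
    case 0
    show ?case by (simp add: birkhoff_sum_def)
  next
    case (Suc n)
    then show ?case
      using v_shift[of "(shift_map ^^ n) x"] by (simp add: birkhoff_sum_def)
  qed
  moreover have "continuous_on X v"
    unfolding v_def
    by (intro continuous_on_divide continuous_on_sum continuous_on_const
          continuous_on_birkhoff_sum assms) (use assms in auto)
  then obtain B where "\<And>x. x \<in> X \<Longrightarrow> \<bar>v x\<bar> \<le> B"
    using bounded_abs by blast
  ultimately show thesis
    by (intro that[of "B + B"]) (metis abs_triangle_ineq4 add_mono funpow_shift_closed order_trans)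
qed

lemma growth_within_perturb:
  assumes "growth_within X f \<rho> \<epsilon>" and "\<And>x. x \<in> X \<Longrightarrow> \<bar>\<rho> x - h x\<bar> \<le> \<delta>"
  shows "growth_within X f h (\<epsilon> + \<delta>)"
  unfolding growth_within_def
proof (rule eventually_mono[OF assms(1)[unfolded growth_within_def]], intro ballI)
  fix n x assume *: "\<forall>x\<in>X. \<bar>ln (f n x) - birkhoff_sum n \<rho> x\<bar> \<le> \<epsilon> * real n" "x \<in> X"
  have "\<bar>birkhoff_sum n (\<lambda>x. \<rho> x - h x) x\<bar> \<le> \<delta> * real n"
    by (rule abs_birkhoff_sum_le[OF assms(2) *(2)])
  moreover have "\<bar>ln (f n x) - birkhoff_sum n \<rho> x\<bar> \<le> \<epsilon> * real n" using * by blast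
  ultimately show "\<bar>ln (f n x) - birkhoff_sum n h x\<bar> \<le> (\<epsilon> + \<delta>) * real n"
    by (simp add: birkhoff_sum_fun_diff algebra_simps abs_le_iff)
qed

text \<open>Both potentials follow \<open>ln f_n\<close>, so the Birkhoff sums of \<open>g\<close>,
  the difference of \<open>\<rho>'\<close> and \<open>\<rho>\<close>, are at most
  \<open>(\<epsilon> + \<epsilon>') * n\<close>, although \<open>g\<close> itself may be large.
  Averaging \<open>g\<close> over one such time \<open>N\<close> makes it uniformly small. The
  average has the Birkhoff sums of \<open>g\<close> up to a constant \<open>D\<close>, so adding it
  to \<open>\<rho>\<close> reproduces the growth of \<open>\<rho>'\<close>; the second
  \<open>\<epsilon>'\<close> absorbs \<open>D\<close>.\<close>

lemma growth_within_refine: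
  assumes "continuous_on X \<rho>" "growth_within X f \<rho> \<epsilon>"
    and "continuous_on X \<rho>'" "growth_within X f \<rho>' \<epsilon>'" "0 < \<epsilon>'"
  obtains \<rho>'' where "continuous_on X \<rho>''" "growth_within X f \<rho>'' (2 * \<epsilon>')"
    "\<And>x. x \<in> X \<Longrightarrow> \<bar>\<rho>'' x - \<rho> x\<bar> \<le> \<epsilon> + \<epsilon>'"
proof -
  define g where "g = (\<lambda>x. \<rho>' x - \<rho> x)"
  have g: "continuous_on X g"
    unfolding g_def by (intro continuous_intros assms)
  have "\<forall>\<^sub>F n in sequentially. \<forall>x\<in>X. \<bar>birkhoff_sum n g x\<bar> \<le> (\<epsilon> + \<epsilon>') * real n"
    using assms(2,4) unfolding growth_within_def
  proof eventually_elim
    case (elim n)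
    show ?case
    proof
      fix x assume "x \<in> X"
      with elim have "\<bar>ln (f n x) - birkhoff_sum n \<rho> x\<bar> \<le> \<epsilon> * real n"
        "\<bar>ln (f n x) - birkhoff_sum n \<rho>' x\<bar> \<le> \<epsilon>' * real n" by auto
      then show "\<bar>birkhoff_sum n g x\<bar> \<le> (\<epsilon> + \<epsilon>') * real n"
        by (simp add: g_def birkhoff_sum_fun_diff algebra_simps abs_le_iff)
    qed
  qed
  then have "\<forall>\<^sub>F n in sequentially. 1 \<le> n \<and> (\<forall>x\<in>X. \<bar>birkhoff_sum n g x\<bar> \<le> (\<epsilon> + \<epsilon>') * real n)"
    using eventually_ge_at_top[of 1] by eventually_elim auto
  then obtain N where N: "1 \<le> N" "\<And>x. x \<in> X \<Longrightarrow> \<bar>birkhoff_sum N g x\<bar> \<le> (\<epsilon> + \<epsilon>') * real N"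
    unfolding eventually_sequentially by blast
  define a where "a = (\<lambda>x. birkhoff_sum N g x / real N)"
  obtain D where D: "\<And>n x. x \<in> X \<Longrightarrow> \<bar>birkhoff_sum n a x - birkhoff_sum n g x\<bar> \<le> D"
    using birkhoff_sum_average[OF g N(1)] unfolding a_def by blast
  show thesis
  proof
    show "continuous_on X (\<lambda>x. \<rho> x + a x)"
      unfolding a_def using N(1)
      by (intro continuous_on_add assms continuous_on_divide continuous_on_birkhoff_sum
            continuous_on_const g) auto
    show "\<bar>\<rho> x + a x - \<rho> x\<bar> \<le> \<epsilon> + \<epsilon>'" if "x \<in> X" for x
      using N(1) N(2)[OF that] by (simp add: a_def divide_simps)
    have "\<forall>\<^sub>F n in sequentially. D \<le> \<epsilon>' * real n"
      by (rule eventually_const_le_mult) fact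
    then show "growth_within X f (\<lambda>x. \<rho> x + a x) (2 * \<epsilon>')"
      using assms(4) unfolding growth_within_def
    proof eventually_elim
      case (elim n)
      show ?case
      proof
        fix x assume x: "x \<in> X"
        have "birkhoff_sum n (\<lambda>x. \<rho> x + a x) x
            = birkhoff_sum n \<rho>' x + (birkhoff_sum n a x - birkhoff_sum n g x)"
          by (simp add: g_def birkhoff_sum_def sum.distrib sum_subtractf)
        then show "\<bar>ln (f n x) - birkhoff_sum n (\<lambda>x. \<rho> x + a x) x\<bar> \<le> 2 * \<epsilon>' * real n"
          using elim(1) bspec[OF elim(2) x] D[OF x, of n] by (simp add: abs_le_iff)
      qed
    qed
  qed
qed

text \<open>Correct the approximating potentials one after the other by coboundaries
  so that they become a uniform Cauchy sequence.\<close>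

lemma growth_within_limit:
  assumes approx: "\<And>\<epsilon>. 0 < \<epsilon> \<Longrightarrow> \<exists>\<rho>. continuous_on X \<rho> \<and> growth_within X f \<rho> \<epsilon>"
  obtains h where "continuous_on X h" "\<And>\<epsilon>. 0 < \<epsilon> \<Longrightarrow> growth_within X f h \<epsilon>"
proof -
  let ?P = "\<lambda>j \<rho>. continuous_on X \<rho> \<and> growth_within X f \<rho> ((1/2) ^ j)"
  let ?Q = "\<lambda>j \<rho> \<rho>'. \<forall>x\<in>X. \<bar>\<rho>' x - \<rho> x\<bar> \<le> 2 * (1/2) ^ j"
  have "\<exists>\<rho>. \<forall>j. ?P j (\<rho> j) \<and> ?Q j (\<rho> j) (\<rho> (Suc j))"
  proof (rule dependent_nat_choice)
    show "\<exists>\<rho>. ?P 0 \<rho>" using approx[of 1] by simp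
    fix \<rho> j assume \<rho>: "?P j \<rho>"
    \<comment> \<open>The exponent is \<open>j + 2\<close> because refining doubles the error, which
      leaves the \<open>(1/2) ^ Suc j\<close> demanded of the next potential.\<close>
    obtain \<rho>1 where \<rho>1: "continuous_on X \<rho>1" "growth_within X f \<rho>1 ((1/2) ^ Suc (Suc j))"
      using approx[of "(1/2) ^ Suc (Suc j)"] by auto
    obtain \<rho>2 where \<rho>2: "continuous_on X \<rho>2" "growth_within X f \<rho>2 (2 * (1/2) ^ Suc (Suc j))"
        "\<And>x. x \<in> X \<Longrightarrow> \<bar>\<rho>2 x - \<rho> x\<bar> \<le> (1/2) ^ j + (1/2) ^ Suc (Suc j)"
      using growth_within_refine[of \<rho> f "(1/2) ^ j" \<rho>1 "(1/2) ^ Suc (Suc j)"] \<rho> \<rho>1 by auto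
    have "(1/2) ^ j + (1/2) ^ Suc (Suc j) \<le> 2 * (1/2 :: real) ^ j" by simp
    then have "?Q j \<rho> \<rho>2" using \<rho>2(3) by (blast intro: order_trans)
    moreover have "?P (Suc j) \<rho>2" using \<rho>2 by simp
    ultimately show "\<exists>\<rho>'. ?P (Suc j) \<rho>' \<and> ?Q j \<rho> \<rho>'" by blast
  qed
  then obtain \<rho> where cont: "\<And>j. continuous_on X (\<rho> j)"
    and growth: "\<And>j. growth_within X f (\<rho> j) ((1/2) ^ j)"
    and step: "\<And>j x. x \<in> X \<Longrightarrow> \<bar>\<rho> (Suc j) x - \<rho> j x\<bar> \<le> 2 * (1/2) ^ j" by blast
  \<comment> \<open>The potentials are \<open>\<rho> 0\<close> plus partial sums of their
    increments, and the increments are dominated by a geometric series.\<close>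
  have "(\<lambda>m x. \<Sum>j<m. \<rho> (Suc j) x - \<rho> j x) = (\<lambda>m x. \<rho> m x - \<rho> 0 x)"
    by (intro ext) (rule sum_lessThan_telescope)
  moreover have "uniformly_convergent_on X (\<lambda>m x. \<Sum>j<m. \<rho> (Suc j) x - \<rho> j x)"
    by (rule Weierstrass_m_test'[where M="\<lambda>j. 2 * (1/2) ^ j"])
       (auto intro: step summable_mult summable_geometric)
  ultimately obtain l where l: "uniform_limit X (\<lambda>m x. \<rho> m x - \<rho> 0 x) l sequentially"
    unfolding uniformly_convergent_on_def by auto
  define h where "h = (\<lambda>x. l x + \<rho> 0 x)"
  have lim: "uniform_limit X \<rho> h sequentially"
    using uniform_limit_add[OF l uniform_limit_const[of "\<rho> 0"]]
    by (simp add: h_def)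
  show thesis
  proof
    show "continuous_on X h"
      by (rule uniform_limit_theorem[OF _ lim]) (simp_all add: cont)
    fix \<epsilon> :: real assume "0 < \<epsilon>"
    \<comment> \<open>Half of \<open>\<epsilon>\<close> pays for replacing \<open>\<rho> j\<close>
      by its limit, the other half for the growth error of \<open>\<rho> j\<close>.\<close>
    have "\<forall>\<^sub>F j in sequentially. \<forall>x\<in>X. dist (\<rho> j x) (h x) < \<epsilon> / 2"
      using uniform_limitD[OF lim, of "\<epsilon> / 2"] \<open>0 < \<epsilon>\<close> by simp
    moreover have "\<forall>\<^sub>F j in sequentially. (1/2 :: real) ^ j < \<epsilon> / 2"
      using \<open>0 < \<epsilon>\<close> by (intro order_tendstoD[OF LIMSEQ_power_zero]) auto
    ultimately have "\<forall>\<^sub>F j in sequentially. (\<forall>x\<in>X. dist (\<rho> j x) (h x) < \<epsilon> / 2) \<and> (1/2 :: real) ^ j < \<epsilon> / 2"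
      by eventually_elim auto
    then obtain j where j: "\<And>x. x \<in> X \<Longrightarrow> \<bar>\<rho> j x - h x\<bar> \<le> \<epsilon> / 2" "(1/2 :: real) ^ j < \<epsilon> / 2"
      unfolding eventually_sequentially dist_real_def by (auto intro: less_imp_le)
    have "growth_within X f h ((1/2) ^ j + \<epsilon> / 2)"
      by (rule growth_within_perturb[OF growth j(1)])
    then show "growth_within X f h \<epsilon>"
      unfolding growth_within_def
    proof (rule eventually_mono, intro ballI)
      fix n x assume "\<forall>x\<in>X. \<bar>ln (f n x) - birkhoff_sum n h x\<bar> \<le> ((1/2) ^ j + \<epsilon> / 2) * real n"
        and "x \<in> X"
      moreover have "((1/2) ^ j + \<epsilon> / 2) * real n \<le> \<epsilon> * real n"
        using j(2) by (intro mult_right_mono) auto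
      ultimately show "\<bar>ln (f n x) - birkhoff_sum n h x\<bar> \<le> \<epsilon> * real n"
        by fastforce
    qed
  qed
qed

end

section \<open>Almost subadditive potentials\<close>

locale almost_subadditive_potential = subshift +
  fixes f :: "nat \<Rightarrow> (nat \<Rightarrow> nat) \<Rightarrow> real" and C :: real
  assumes potential_seq: "potential_seq X f"
    and tempered: "tempered_variation X f"
    and C_nonneg: "0 \<le> C"
    and subadditive: "subadditive_seq X (\<lambda>n x. exp C * f n x)"
begin

lemma f_pos: "1 \<le> n \<Longrightarrow> x \<in> X \<Longrightarrow> 0 < f n x"
  using potential_seq by (auto simp: potential_seq_def)

lemma continuous_f: "1 \<le> n \<Longrightarrow> continuous_on X (f n)"
  using potential_seq by (auto simp: potential_seq_def)

lemma continuous_ln_f: "1 \<le> n \<Longrightarrow> continuous_on X (\<lambda>x. ln (f n x))"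
  using f_pos by (intro continuous_on_ln continuous_f) force+

lemma ln_f_subadditive:
  assumes "1 \<le> n" "1 \<le> m" "x \<in> X"
  shows "ln (f (n + m) x) \<le> C + ln (f n x) + ln (f m ((shift_map ^^ n) x))"
proof -
  have y: "(shift_map ^^ n) x \<in> X" using assms by (simp add: funpow_shift_closed)
  have pos: "0 < f (n + m) x" "0 < f n x" "0 < f m ((shift_map ^^ n) x)"
    using assms y by (auto intro: f_pos)
  have "exp C * f (n + m) x \<le> exp C * f n x * (exp C * f m ((shift_map ^^ n) x))"
    using subadditive assms by (auto simp: subadditive_seq_def)
  then have "f (n + m) x \<le> exp C * f n x * f m ((shift_map ^^ n) x)"
    by (simp add: mult_ac)
  then have "ln (f (n + m) x) \<le> ln (exp C * f n x * f m ((shift_map ^^ n) x))"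
    using pos by (intro ln_mono) auto
  then show ?thesis using pos by (simp add: ln_mult)
qed

text \<open>For \<open>n \<ge> 1\<close> the function \<open>ln (f n x)\<close> is bounded on the
  compact \<open>X\<close>, so the set of quotients is bounded above and its \<open>Sup\<close>
  really dominates each of them.\<close>

lemma ln_f_variation:
  assumes "0 < \<epsilon>"
  shows "\<forall>\<^sub>F n in sequentially. \<forall>x\<in>X. \<forall>y\<in>X. (\<forall>i<n. x i = y i) \<longrightarrow>
    ln (f n x) - ln (f n y) \<le> \<epsilon> * real n"
proof -
  define Q where "Q = (\<lambda>n. {f n x / f n y |x y. x \<in> X \<and> y \<in> X \<and> (\<forall>i<n. x i = y i)})"
  have "\<forall>\<^sub>F n in sequentially. \<bar>ln (Sup (Q n))\<bar> \<le> \<epsilon> * real n"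
    using tempered assms unfolding tempered_variation_def Q_def
    by (rule tendsto_zero_imp_eventually_le)
  then show ?thesis
    using eventually_ge_at_top[of 1]
  proof (eventually_elim, intro ballI impI)
    fix n x y
    assume n: "\<bar>ln (Sup (Q n))\<bar> \<le> \<epsilon> * real n" "1 \<le> n"
      and xy: "x \<in> X" "y \<in> X" "\<forall>i<n. x i = y i"
    obtain B where B: "\<And>x. x \<in> X \<Longrightarrow> \<bar>ln (f n x)\<bar> \<le> B"
      using bounded_abs[OF continuous_ln_f[OF n(2)]] by blast
    have "f n x / f n y = exp (ln (f n x) - ln (f n y))" if "x \<in> X" "y \<in> X" for x y
      using f_pos[OF n(2)] that by (simp add: exp_diff)
    moreover have "ln (f n x) - ln (f n y) \<le> B + B" if "x \<in> X" "y \<in> X" for x y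
      using B[OF that(1)] B[OF that(2)] by linarith
    ultimately have "bdd_above (Q n)"
      unfolding Q_def by (intro bdd_aboveI[of _ "exp (B + B)"]) auto
    moreover have "f n x / f n y \<in> Q n"
      unfolding Q_def using xy by blast
    ultimately have "f n x / f n y \<le> Sup (Q n)"
      by (rule cSup_upper[rotated])
    then have "ln (f n x / f n y) \<le> ln (Sup (Q n))"
      using f_pos[OF n(2)] xy by (intro ln_mono) auto
    then show "ln (f n x) - ln (f n y) \<le> \<epsilon> * real n"
      using n f_pos[OF n(2) xy(1)] f_pos[OF n(2) xy(2)] by (simp add: ln_div)
  qed
qed

text \<open>Cutting at most \<open>k\<close> steps off either end of an orbit segment costs a
  constant independent of \<open>n\<close>, since the discarded factor is one of finitely many
  bounded functions. The sum in \<open>K\<close> bounds all of them at once. The case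
  \<open>j = 0\<close>, about which subadditivity says nothing, is covered by
  \<open>0 \<le> K\<close>.\<close>

lemma ln_f_trim:
  obtains K where "0 \<le> K" and
    "\<And>n j x. \<lbrakk>1 \<le> n; j \<le> k; x \<in> X\<rbrakk> \<Longrightarrow> ln (f (n + j) x) \<le> K + ln (f n x)"
    "\<And>n j x. \<lbrakk>1 \<le> n; j \<le> k; x \<in> X\<rbrakk> \<Longrightarrow> ln (f (j + n) x) \<le> K + ln (f n ((shift_map ^^ j) x))"
proof -
  have "\<exists>B. \<forall>x\<in>X. \<bar>ln (f j x)\<bar> \<le> B" if "1 \<le> j" for j
    using bounded_abs[OF continuous_ln_f[OF that]] by metis
  then obtain B where B: "\<And>j x. \<lbrakk>1 \<le> j; x \<in> X\<rbrakk> \<Longrightarrow> \<bar>ln (f j x)\<bar> \<le> B j" by metis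
  define K where "K = C + (\<Sum>j\<le>k. \<bar>B j\<bar>)"
  have K: "C + ln (f j x) \<le> K" if "1 \<le> j" "j \<le> k" "x \<in> X" for j x
  proof -
    have "\<bar>B j\<bar> \<le> (\<Sum>j\<le>k. \<bar>B j\<bar>)" using that by (intro member_le_sum) auto
    then show ?thesis using B[of j x] that by (simp add: K_def)
  qed
  have "0 \<le> K" using C_nonneg by (simp add: K_def sum_nonneg)
  show thesis
  proof
    fix n j :: nat and x assume *: "1 \<le> n" "j \<le> k" "x \<in> X"
    show "ln (f (n + j) x) \<le> K + ln (f n x)"
      using ln_f_subadditive[of n j x] K[of j "(shift_map ^^ n) x"] * \<open>0 \<le> K\<close>
      by (cases "j = 0") (auto simp: funpow_shift_closed)
    show "ln (f (j + n) x) \<le> K + ln (f n ((shift_map ^^ j) x))"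
      using ln_f_subadditive[of j n x] K[of j x] * \<open>0 \<le> K\<close>
      by (cases "j = 0") auto
  qed fact
qed

end

lemma pow_le_iff_ln:
  assumes "0 < a" "0 < b"
  shows "a ^ j \<le> b \<longleftrightarrow> real j * ln a \<le> ln b"
  using assms by (metis ln_le_cancel_iff ln_realpow zero_less_power)

section \<open>Uniform growth, asymptotic additivity and growth at points\<close>

context almost_subadditive_potential
begin

lemma birkhoff_asymptotic_uniformly_iff:
  assumes "continuous_on X h"
  shows "birkhoff_asymptotic_uniformly X f h \<longleftrightarrow> (\<forall>\<epsilon>>0. growth_within X f h \<epsilon>)"
proof -
  let ?g = "\<lambda>n x. ln (f n x / exp (birkhoff_sum n h x))"
  have g: "?g n x = ln (f n x) - birkhoff_sum n h x" if "1 \<le> n" "x \<in> X" for n x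
    using f_pos[OF that] by (simp add: ln_div)
  have "continuous_on X (?g n)" if "1 \<le> n" for n
    using continuous_on_diff[OF continuous_ln_f[OF that] continuous_on_birkhoff_sum[OF assms, of n]]
    by (subst continuous_on_cong[OF refl g[OF that]])
  then have "birkhoff_asymptotic_uniformly X f h \<longleftrightarrow>
      (\<forall>\<epsilon>>0. \<forall>\<^sub>F n in sequentially. \<forall>x\<in>X. \<bar>?g n x\<bar> \<le> \<epsilon> * real n)"
    unfolding birkhoff_asymptotic_uniformly_def by (rule sup_norm_tendsto_iff)
  moreover have "(\<forall>\<^sub>F n in sequentially. \<forall>x\<in>X. \<bar>?g n x\<bar> \<le> \<epsilon> * real n) \<longleftrightarrow> growth_within X f h \<epsilon>" for \<epsilon>
    unfolding growth_within_def
    by (intro eventually_cong[OF eventually_ge_at_top[of 1]] ball_cong refl) (simp add: g)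
  ultimately show ?thesis by simp
qed

lemma growth_within_imp_asymptotically_additive:
  assumes "continuous_on X h" and "\<And>\<epsilon>. 0 < \<epsilon> \<Longrightarrow> growth_within X f h \<epsilon>"
  shows "asymptotically_additive X f"
proof -
  let ?g = "\<lambda>n x. ln (f n x) - birkhoff_sum n h x"
  have "continuous_on X (?g n)" if "1 \<le> n" for n
    using continuous_on_diff[OF continuous_ln_f[OF that] continuous_on_birkhoff_sum[OF assms(1), of n]] .
  then have "(\<lambda>n. 1 / real n * sup_norm X (?g n)) \<longlonglongrightarrow> 0"
    using assms(2) unfolding growth_within_def by (subst sup_norm_tendsto_iff) auto
  then have "(\<lambda>n. ereal (1 / real n * sup_norm X (?g n))) \<longlonglongrightarrow> ereal 0"
    by (rule tendsto_ereal)
  then have "limsup (\<lambda>n. ereal (1 / real n * sup_norm X (?g n))) = ereal 0"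
    by (intro lim_imp_Limsup) auto
  then show ?thesis
    using assms(1) unfolding asymptotically_additive_def by auto
qed

text \<open>Cuneo's theorem: a limsup strictly below \<open>\<epsilon>\<close> gives one potential
  for each \<open>\<epsilon>\<close>, and the limit construction for corrected potentials merges
  them into a single one.\<close>

lemma asymptotically_additive_imp_growth_within:
  assumes "asymptotically_additive X f"
  obtains h where "continuous_on X h" "\<And>\<epsilon>. 0 < \<epsilon> \<Longrightarrow> growth_within X f h \<epsilon>"
proof (rule growth_within_limit)
  fix \<epsilon> :: real assume "0 < \<epsilon>"
  with assms obtain \<rho> where \<rho>: "continuous_on X \<rho>" and
    "limsup (\<lambda>n. ereal (1 / real n * sup_norm X (\<lambda>x. ln (f n x) - birkhoff_sum n \<rho> x))) < ereal \<epsilon>"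
    unfolding asymptotically_additive_def by blast
  then have "\<forall>\<^sub>F n in sequentially.
      ereal (1 / real n * sup_norm X (\<lambda>x. ln (f n x) - birkhoff_sum n \<rho> x)) < ereal \<epsilon>"
    by (intro Limsup_lessD)
  then have "growth_within X f \<rho> \<epsilon>"
    unfolding growth_within_def using eventually_ge_at_top[of 1]
  proof (eventually_elim, intro ballI)
    fix n x
    assume *: "ereal (1 / real n * sup_norm X (\<lambda>x. ln (f n x) - birkhoff_sum n \<rho> x)) < ereal \<epsilon>"
      "1 \<le> n" "x \<in> X"
    have "\<bar>ln (f n x) - birkhoff_sum n \<rho> x\<bar> \<le> sup_norm X (\<lambda>x. ln (f n x) - birkhoff_sum n \<rho> x)"
      using * by (intro sup_norm_upper continuous_on_diff continuous_ln_f continuous_on_birkhoff_sum \<rho>)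
    moreover have "sup_norm X (\<lambda>x. ln (f n x) - birkhoff_sum n \<rho> x) \<le> \<epsilon> * real n"
      using *(1,2) by (simp add: field_simps)
    ultimately show "\<bar>ln (f n x) - birkhoff_sum n \<rho> x\<bar> \<le> \<epsilon> * real n" by linarith
  qed
  with \<rho> show "\<exists>\<rho>. continuous_on X \<rho> \<and> growth_within X f \<rho> \<epsilon>" by blast
qed (rule that)

lemma birkhoff_asymptotic_at_iff:
  assumes "x \<in> X"
  shows "birkhoff_asymptotic_at f h x \<longleftrightarrow>
    (\<lambda>n. 1 / real n * (ln (f n x) - birkhoff_sum n h x)) \<longlonglongrightarrow> 0"
  unfolding birkhoff_asymptotic_at_def
proof (intro filterlim_cong refl eventually_mono[OF eventually_ge_at_top[of 1]])
  fix n :: nat assume "1 \<le> n"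
  then show "1 / real n * ln (f n x / exp (birkhoff_sum n h x))
      = 1 / real n * (ln (f n x) - birkhoff_sum n h x)"
    using f_pos[OF _ assms, of n] by (simp add: ln_div)
qed

lemma growth_within_imp_birkhoff_asymptotic_at:
  assumes "\<And>\<epsilon>. 0 < \<epsilon> \<Longrightarrow> growth_within X f h \<epsilon>" and "x \<in> X"
  shows "birkhoff_asymptotic_at f h x"
  unfolding birkhoff_asymptotic_at_iff[OF assms(2)]
proof (rule eventually_le_imp_tendsto_zero)
  fix \<epsilon> :: real assume "0 < \<epsilon>"
  from assms(1)[OF this]
  show "\<forall>\<^sub>F n in sequentially. \<bar>ln (f n x) - birkhoff_sum n h x\<bar> \<le> \<epsilon> * real n"
    unfolding growth_within_def by (rule eventually_mono) (use assms(2) in blast)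
qed

text \<open>Along multiples of the period the Birkhoff sum is exactly \<open>j\<close> times that of
  one turn, so the growth limit, restricted to this subsequence and multiplied by \<open>p\<close>,
  becomes a limit per turn.\<close>

lemma birkhoff_asymptotic_at_period:
  assumes "birkhoff_asymptotic_at f h z" and "z \<in> X" "(shift_map ^^ p) z = z" "1 \<le> p"
  shows "(\<lambda>j. ln (f (j * p) z) / real j) \<longlonglongrightarrow> birkhoff_sum p h z"
proof -
  have "strict_mono (\<lambda>j. j * p)"
    using assms(4) by (simp add: strict_mono_def)
  from LIMSEQ_subseq_LIMSEQ[OF assms(1)[unfolded birkhoff_asymptotic_at_iff[OF assms(2)]] this]
  have "(\<lambda>j. 1 / (real j * real p) * (ln (f (j * p) z) - real j * birkhoff_sum p h z)) \<longlonglongrightarrow> 0"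
    by (simp add: o_def birkhoff_sum_periodic[OF assms(3)])
  then have "(\<lambda>j. real p * (1 / (real j * real p) * (ln (f (j * p) z) - real j * birkhoff_sum p h z))
      + birkhoff_sum p h z) \<longlonglongrightarrow> real p * 0 + birkhoff_sum p h z"
    by (intro tendsto_intros)
  then have lim: "(\<lambda>j. real p * (1 / (real j * real p) * (ln (f (j * p) z) - real j * birkhoff_sum p h z))
      + birkhoff_sum p h z) \<longlonglongrightarrow> birkhoff_sum p h z"
    by simp
  show ?thesis
    by (rule Lim_transform_eventually[OF lim eventually_mono[OF eventually_ge_at_top[of 1]]])
       (use assms(4) in \<open>simp add: field_simps\<close>)
qed

text \<open>Each further turn round the orbit costs one \<open>C\<close> by subadditivity; this will
  bound the limit per turn from above.\<close>

lemma ln_f_periodic_le: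
  assumes "z \<in> X" "(shift_map ^^ p) z = z" "1 \<le> p" "1 \<le> j"
  shows "ln (f (j * p) z) \<le> real j * (ln (f p z) + C)"
  using assms(4)
proof (induction j rule: dec_induct)
  case base
  show ?case using C_nonneg by simp
next
  case (step j)
  have "ln (f (j * p + p) z) \<le> C + ln (f (j * p) z) + ln (f p z)"
    using ln_f_subadditive[of "j * p" p z] step assms by (simp add: funpow_mult_fixed)
  then show ?case using step.IH by (simp add: algebra_simps)
qed

lemma birkhoff_asymptotic_periodic_imp_growth_within:
  assumes h: "continuous_on X h" and plb: "periodic_lower_bound X f"
    and per: "\<And>x. \<lbrakk>x \<in> X; periodic_point x\<rbrakk> \<Longrightarrow> birkhoff_asymptotic_at f h x"
    and "0 < \<epsilon>"
  shows "growth_within X f h \<epsilon>"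
proof -
  obtain k c M where "0 \<le> c" and M: "\<And>n. n \<ge> 1 \<Longrightarrow> 0 < M n"
    and M_lim: "(\<lambda>n. 1 / real n * ln (M n)) \<longlonglongrightarrow> 0"
    and lower: "\<And>\<delta>. 0 < \<delta> \<Longrightarrow> \<delta> < 1 \<Longrightarrow> \<exists>N\<ge>1. \<forall>n\<ge>N. \<forall>u\<in>words_of_length n X.
          \<exists>q\<le>k. \<exists>w\<in>words_of_length q X.
            periodic_word (u @ w) \<in> X \<and>
            (\<forall>j\<ge>1. f (j * (n + q)) (periodic_word (u @ w))
               \<ge> (M n * exp (- c * real n * \<delta>)) ^ j * (SUP x\<in>cylinder X u. f n x) ^ j)"
    using plb unfolding periodic_lower_bound_def by blast
  \<comment> \<open>Condition (ii) loses \<open>c * \<delta> * n\<close>, which must stay below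
    \<open>\<epsilon> / 8 * n\<close>. The denominator has \<open>c + 1\<close> since
    \<open>c\<close> may be 0, and the minimum keeps \<open>\<delta>\<close> below 1.\<close>
  define \<delta> where "\<delta> = min (1/2) (\<epsilon> / (8 * (c + 1)))"
  have \<delta>: "0 < \<delta>" "\<delta> < 1"
    using \<open>0 < \<epsilon>\<close> \<open>0 \<le> c\<close> by (auto simp: \<delta>_def)
  have "c * \<delta> \<le> (c + 1) * (\<epsilon> / (8 * (c + 1)))"
    using \<open>0 \<le> c\<close> \<open>0 < \<epsilon>\<close> by (intro mult_mono) (auto simp: \<delta>_def)
  also have "(c + 1) * (\<epsilon> / (8 * (c + 1))) = \<epsilon> / 8"
    using \<open>0 \<le> c\<close> by (simp add: divide_simps)
  finally have c\<delta>: "c * \<delta> \<le> \<epsilon> / 8" .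
  obtain N where N: "\<And>n u. \<lbrakk>n \<ge> N; u \<in> words_of_length n X\<rbrakk> \<Longrightarrow> \<exists>q\<le>k. \<exists>w\<in>words_of_length q X.
            periodic_word (u @ w) \<in> X \<and>
            (\<forall>j\<ge>1. f (j * (n + q)) (periodic_word (u @ w))
               \<ge> (M n * exp (- c * real n * \<delta>)) ^ j * (SUP x\<in>cylinder X u. f n x) ^ j)"
    using lower[OF \<delta>] by blast
  obtain B where "0 \<le> B" and B: "\<And>x. x \<in> X \<Longrightarrow> \<bar>h x\<bar> \<le> B"
    using bounded_abs[OF h] by blast
  obtain K where "0 \<le> K" and
    K: "\<And>n j x. \<lbrakk>1 \<le> n; j \<le> k; x \<in> X\<rbrakk> \<Longrightarrow> ln (f (n + j) x) \<le> K + ln (f n x)"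
    using ln_f_trim by metis
  \<comment> \<open>Each of the two final inequalities collects at most four errors of size
    \<open>\<epsilon> / 8 * n\<close>, taken from \<open>M n\<close>,
    \<open>c * \<delta> * n\<close>, the variation of \<open>f n\<close>, the variation of the
    Birkhoff sum, and the constants caused by the \<open>q \<le> k\<close> extra steps and by
    \<open>C\<close>.\<close>
  have "0 < \<epsilon> / 8" using \<open>0 < \<epsilon>\<close> by simp
  note ev = tendsto_zero_imp_eventually_le[OF M_lim this] ln_f_variation[OF this]
    birkhoff_sum_variation[OF h this] eventually_const_le_mult[OF this, of "B * real k + K + C"]
    eventually_ge_at_top[of N] eventually_ge_at_top[of 1]
  show ?thesis
    unfolding growth_within_def using ev
  proof (eventually_elim, intro ballI)
    fix n x
    assume Mn: "\<bar>ln (M n)\<bar> \<le> \<epsilon> / 8 * real n"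
      and var_f: "\<forall>x\<in>X. \<forall>y\<in>X. (\<forall>i<n. x i = y i) \<longrightarrow> ln (f n x) - ln (f n y) \<le> \<epsilon> / 8 * real n"
      and var_h: "\<forall>x\<in>X. \<forall>y\<in>X. (\<forall>i<n. x i = y i) \<longrightarrow>
        \<bar>birkhoff_sum n h x - birkhoff_sum n h y\<bar> \<le> \<epsilon> / 8 * real n"
      and const: "B * real k + K + C \<le> \<epsilon> / 8 * real n" and "N \<le> n" "1 \<le> n" and x: "x \<in> X"
    define u where "u = map x [0..<n]"
    have "u \<in> words_of_length n X"
      using x \<open>1 \<le> n\<close> unfolding words_of_length_def appears_in_def u_def by (auto intro!: bexI[of _ x] exI[of _ 0])
    then obtain q w where q: "q \<le> k" and w: "w \<in> words_of_length q X"
      and z: "periodic_word (u @ w) \<in> X"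
      and ge: "\<And>j. 1 \<le> j \<Longrightarrow> (M n * exp (- c * real n * \<delta>)) ^ j * (SUP x\<in>cylinder X u. f n x) ^ j
        \<le> f (j * (n + q)) (periodic_word (u @ w))"
      using N[OF \<open>N \<le> n\<close>] by blast
    define z where "z = periodic_word (u @ w)"
    define p where "p = n + q"
    define s where "s = (SUP x\<in>cylinder X u. f n x)"
    have "z \<in> X" using z by (simp add: z_def)
    have "length (u @ w) = p"
      using w by (auto simp: words_of_length_def u_def p_def split: if_splits)
    then have period: "(shift_map ^^ p) z = z"
      using periodic_word_period[of "u @ w"] by (simp add: z_def)
    have "1 \<le> p" using \<open>1 \<le> n\<close> by (simp add: p_def)
    have prefix: "x i = z i" "z i = x i" if "i < n" for i
      using periodic_word_prefix[of i u w] that by (auto simp: z_def u_def)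

    have lim: "(\<lambda>j. ln (f (j * p) z) / real j) \<longlonglongrightarrow> birkhoff_sum p h z"
      using per[OF \<open>z \<in> X\<close>] period \<open>1 \<le> p\<close> \<open>z \<in> X\<close>
      by (intro birkhoff_asymptotic_at_period) (auto simp: periodic_point_def)
    \<comment> \<open>Upper bound: every term with \<open>j \<ge> 1\<close> lies below
      \<open>ln (f p z) + C\<close>, hence so does the limit.\<close>
    have "\<exists>N. \<forall>j\<ge>N. ln (f (j * p) z) / real j \<le> ln (f p z) + C"
      using ln_f_periodic_le[OF \<open>z \<in> X\<close> period \<open>1 \<le> p\<close>]
      by (intro exI[of _ 1]) (auto simp: field_simps)
    then have sum_le: "birkhoff_sum p h z \<le> ln (f p z) + C"
      by (rule LIMSEQ_le_const2[OF lim])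

    have cyl: "cylinder X u \<subseteq> X" "x \<in> cylinder X u"
      using x by (auto simp: cylinder_def u_def)
    have "bdd_above (f n ` cylinder X u)"
      by (rule bdd_above_mono[OF bounded_imp_bdd_above[OF compact_imp_bounded[OF
            compact_continuous_image[OF continuous_f[OF \<open>1 \<le> n\<close>] compact]]]]) (use cyl in blast)
    then have "f n x \<le> s"
      unfolding s_def using cyl(2) by (rule cSUP_upper[rotated])
    then have "0 < s" "ln (f n x) \<le> ln s"
      using f_pos[OF \<open>1 \<le> n\<close> x] by (auto intro: ln_mono)
    \<comment> \<open>Lower bound: condition (ii) reads \<open>a ^ j \<le> f (j * p) z\<close>.
      Taking logarithms and dividing by \<open>j\<close> leaves the constant \<open>ln a\<close>
      below the sequence, so the limit in \<open>j\<close> retains the full bound.\<close>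
    define a where "a = M n * exp (- c * real n * \<delta>) * s"
    have "0 < a" using M[OF \<open>1 \<le> n\<close>] \<open>0 < s\<close> by (simp add: a_def)
    have "ln a = ln (M n) - c * \<delta> * real n + ln s"
      using M[OF \<open>1 \<le> n\<close>] \<open>0 < s\<close> by (simp add: a_def ln_mult algebra_simps)
    moreover have "ln a \<le> ln (f (j * p) z) / real j" if "1 \<le> j" for j
    proof -
      have "a ^ j \<le> f (j * p) z"
        using ge[OF that] by (simp add: a_def s_def z_def p_def power_mult_distrib)
      moreover have "0 < f (j * p) z"
        using that \<open>1 \<le> p\<close> by (intro f_pos \<open>z \<in> X\<close>) simp
      ultimately have "real j * ln a \<le> ln (f (j * p) z)"
        using \<open>0 < a\<close> by (simp add: pow_le_iff_ln)
      then show ?thesis using that by (simp add: field_simps)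
    qed
    then have "ln a \<le> birkhoff_sum p h z"
      by (intro LIMSEQ_le_const[OF lim]) blast
    ultimately have le_sum: "ln (M n) - c * \<delta> * real n + ln (f n x) \<le> birkhoff_sum p h z"
      using \<open>ln (f n x) \<le> ln s\<close> by linarith

    have "\<bar>birkhoff_sum q h ((shift_map ^^ n) z)\<bar> \<le> B * real q"
      by (rule abs_birkhoff_sum_le[OF B]) (auto intro: funpow_shift_closed \<open>z \<in> X\<close>)
    also have "\<dots> \<le> B * real k"
      using q \<open>0 \<le> B\<close> by (intro mult_left_mono) auto
    finally have tail: "\<bar>birkhoff_sum p h z - birkhoff_sum n h z\<bar> \<le> B * real k"
      by (simp add: p_def birkhoff_sum_add)
    have "c * \<delta> * real n \<le> \<epsilon> / 8 * real n"
      using c\<delta> by (intro mult_right_mono) auto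
    moreover have "\<bar>birkhoff_sum n h x - birkhoff_sum n h z\<bar> \<le> \<epsilon> / 8 * real n"
      using var_h x \<open>z \<in> X\<close> prefix by blast
    moreover have "ln (f n z) - ln (f n x) \<le> \<epsilon> / 8 * real n"
      using var_f x \<open>z \<in> X\<close> prefix by blast
    \<comment> \<open>Subadditivity compares \<open>f p\<close> with \<open>f n\<close> in this
      direction only. The opposite inequality never involves \<open>f p\<close>, because condition
      (ii) is stated with the supremum of \<open>f n\<close>.\<close>
    moreover have "ln (f p z) \<le> K + ln (f n z)"
      unfolding p_def by (rule K[OF \<open>1 \<le> n\<close> q \<open>z \<in> X\<close>])
    moreover have "0 \<le> B * real k" using \<open>0 \<le> B\<close> by simp
    moreover have "8 * (\<epsilon> / 8 * real n) = \<epsilon> * real n" by simp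
    ultimately show "\<bar>ln (f n x) - birkhoff_sum n h x\<bar> \<le> \<epsilon> * real n"
      using sum_le le_sum tail Mn const C_nonneg \<open>0 \<le> K\<close> unfolding abs_le_iff by linarith
  qed
qed

end

section \<open>Invariant measures\<close>

context subshift
begin

lemma
  fixes g :: "(nat \<Rightarrow> nat) \<Rightarrow> real"
  assumes "\<mu> \<in> invariant_measures X"
  shows invariant_prob_space: "prob_space \<mu>"
    and space_invariant: "space \<mu> = X"
    and borel_measurable_invariant:
      "continuous_on X g \<Longrightarrow> g \<in> borel_measurable \<mu>"
proof -
  have sets: "sets \<mu> = sets (restrict_space borel X)"
    using assms by (simp add: invariant_measures_def)
  show "prob_space \<mu>" using assms by (simp add: invariant_measures_def)
  show "space \<mu> = X"
    using sets_eq_imp_space_eq[OF sets] by (simp add: space_restrict_space)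
  show "continuous_on X g \<Longrightarrow> g \<in> borel_measurable \<mu>"
    using borel_measurable_continuous_on_restrict[of X g] measurable_cong_sets[OF sets refl]
    by blast
qed

lemma integrable_invariant:
  fixes g :: "(nat \<Rightarrow> nat) \<Rightarrow> real"
  assumes "\<mu> \<in> invariant_measures X" and "continuous_on X g"
  shows "integrable \<mu> g"
proof -
  interpret prob_space \<mu> by (rule invariant_prob_space) fact
  obtain B where "\<And>x. x \<in> X \<Longrightarrow> \<bar>g x\<bar> \<le> B"
    using bounded_abs[OF assms(2)] by blast
  then show ?thesis
    using borel_measurable_invariant[OF assms] space_invariant[OF assms(1)]
    by (intro integrable_const_bound[of _ B]) auto
qed

lemma measurable_shift_map:
  "shift_map \<in> measurable (restrict_space borel X) (restrict_space borel X)"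
proof (rule measurable_restrict_space2)
  show "shift_map \<in> space (restrict_space borel X) \<rightarrow> X"
    by (auto simp: space_restrict_space shift_closed)
  show "shift_map \<in> borel_measurable (restrict_space borel X)"
    using continuous_on_shift_map_funpow[of X 1]
    by (intro borel_measurable_continuous_on_restrict) simp
qed

lemma integral_shift_map_funpow:
  fixes g :: "(nat \<Rightarrow> nat) \<Rightarrow> real"
  assumes \<mu>: "\<mu> \<in> invariant_measures X" and g: "continuous_on X g"
  shows "(\<integral>x. g ((shift_map ^^ i) x) \<partial>\<mu>) = (\<integral>x. g x \<partial>\<mu>)"
proof (induction i)
  case (Suc i)
  let ?g = "\<lambda>x. g ((shift_map ^^ i) x)"
  have sets: "sets \<mu> = sets (restrict_space borel X)" and inv: "distr \<mu> \<mu> shift_map = \<mu>"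
    using \<mu> by (simp_all add: invariant_measures_def)
  have "shift_map \<in> measurable \<mu> \<mu>"
    using measurable_shift_map measurable_cong_sets[OF sets sets] by blast
  moreover have "?g \<in> borel_measurable \<mu>"
    by (intro borel_measurable_invariant \<mu> continuous_on_comp_shift g)
  ultimately have "(\<integral>x. ?g x \<partial>distr \<mu> \<mu> shift_map) = (\<integral>x. ?g (shift_map x) \<partial>\<mu>)"
    by (rule integral_distr)
  then show ?case
    using Suc.IH by (simp add: inv funpow_swap1)
qed simp

lemma integral_birkhoff_sum:
  assumes "\<mu> \<in> invariant_measures X" and "continuous_on X h"
  shows "(\<integral>x. birkhoff_sum n h x \<partial>\<mu>) = real n * (\<integral>x. h x \<partial>\<mu>)"
  unfolding birkhoff_sum_def
  by (subst Bochner_Integration.integral_sum)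
     (auto intro!: integrable_invariant continuous_on_comp_shift assms
       simp: integral_shift_map_funpow[OF assms])

text \<open>The measure is the image of the uniform distribution on \<open>{..<l}\<close> under
  \<open>i \<mapsto> (shift_map ^^ i) x\<close>. This map carries the rotation of indices modulo
  \<open>l\<close> to the shift, and the rotation permutes \<open>{..<l}\<close>, which gives
  invariance. Since indices rather than points are averaged, \<open>l\<close> may be any period, not
  just the least one.\<close>

lemma periodic_orbit_measure:
  assumes x: "x \<in> X" and period: "(shift_map ^^ l) x = x" and "1 \<le> l"
  obtains \<mu> where "\<mu> \<in> invariant_measures X"
    "\<And>g :: (nat \<Rightarrow> nat) \<Rightarrow> real. continuous_on X g \<Longrightarrow>
      (\<integral>y. g y \<partial>\<mu>) = (\<Sum>i<l. g ((shift_map ^^ i) x)) / real l"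
proof -
  define R where "R = restrict_space borel X"
  define p where "p = pmf_of_set {..<l}"
  define orb where "orb = (\<lambda>i. (shift_map ^^ i) x)"
  define rot where "rot = (\<lambda>i. Suc i mod l)"
  define \<mu> where "\<mu> = distr (measure_pmf p) R orb"
  have orb: "orb \<in> measurable (measure_pmf p) R"
    unfolding orb_def R_def by (auto simp: space_restrict_space funpow_shift_closed x)
  have "inj_on rot {..<l}"
    unfolding rot_def by (auto simp: inj_on_def mod_Suc split: if_splits)
  moreover have "rot ` {..<l} \<subseteq> {..<l}"
    unfolding rot_def using \<open>1 \<le> l\<close> by auto
  ultimately have "bij_betw rot {..<l} {..<l}"
    by (simp add: bij_betw_def endo_inj_surj)
  then have rot: "map_pmf rot p = p"
    unfolding p_def using \<open>1 \<le> l\<close> by (intro map_pmf_of_set_bij_betw) (auto simp: lessThan_empty_iff)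
  have "shift_map \<circ> orb = orb \<circ> rot"
    unfolding orb_def rot_def o_def by (simp add: funpow_mod_eq[OF period] del: funpow.simps(2)) simp
  have "distr \<mu> \<mu> shift_map = distr \<mu> R shift_map"
    by (rule distr_cong) (simp_all add: \<mu>_def)
  also have "\<dots> = distr (measure_pmf p) R (shift_map \<circ> orb)"
    unfolding \<mu>_def using measurable_shift_map orb by (intro distr_distr) (simp_all add: R_def)
  also have "\<dots> = distr (distr (measure_pmf p) (count_space UNIV) rot) R orb"
    unfolding \<open>shift_map \<circ> orb = orb \<circ> rot\<close>
    using orb by (intro distr_distr[symmetric]) (simp_all add: R_def space_restrict_space)
  also have "\<dots> = \<mu>"
    unfolding map_pmf_rep_eq[symmetric] rot \<mu>_def ..
  finally have "distr \<mu> \<mu> shift_map = \<mu>" .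
  moreover have "prob_space \<mu>"
    unfolding \<mu>_def by (rule prob_space.prob_space_distr[OF prob_space_measure_pmf orb])
  ultimately have "\<mu> \<in> invariant_measures X"
    by (simp add: invariant_measures_def \<mu>_def R_def)
  moreover have "(\<integral>y. g y \<partial>\<mu>) = (\<Sum>i<l. g ((shift_map ^^ i) x)) / real l"
    if "continuous_on X g" for g :: "(nat \<Rightarrow> nat) \<Rightarrow> real"
  proof -
    have "g \<in> borel_measurable R"
      unfolding R_def by (rule borel_measurable_continuous_on_restrict) fact
    then have "(\<integral>y. g y \<partial>\<mu>) = (\<integral>i. g (orb i) \<partial>measure_pmf p)"
      unfolding \<mu>_def by (intro integral_distr orb)
    then show ?thesis
      unfolding p_def orb_def using \<open>1 \<le> l\<close> by (subst (asm) integral_pmf_of_set) (auto simp: lessThan_empty_iff)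
  qed
  ultimately show thesis by (rule that)
qed

text \<open>Divide \<open>n\<close> by \<open>l\<close> with remainder: the full turns cancel
  exactly against the mean, and the fewer than \<open>l\<close> remaining terms on each side amount
  to at most \<open>B * l\<close>.\<close>

lemma birkhoff_sum_periodic_average:
  assumes h: "continuous_on X h" and x: "x \<in> X" "(shift_map ^^ l) x = x" and "1 \<le> l"
  obtains D where "\<And>n. \<bar>birkhoff_sum n h x - real n * (birkhoff_sum l h x / real l)\<bar> \<le> D"
proof -
  obtain B where "0 \<le> B" and B: "\<And>x. x \<in> X \<Longrightarrow> \<bar>h x\<bar> \<le> B"
    using bounded_abs[OF h] by blast
  define T where "T = birkhoff_sum l h x / real l"
  have "\<bar>birkhoff_sum n h x - real n * T\<bar> \<le> 2 * (B * real l)" for n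
  proof -
    define j r where "j = n div l" "r = n mod l"
    have n: "n = j * l + r" and "r < l" using \<open>1 \<le> l\<close> by (simp_all add: j_r_def)
    have "birkhoff_sum n h x = real j * birkhoff_sum l h x + birkhoff_sum r h x"
      unfolding n birkhoff_sum_add by (simp add: birkhoff_sum_periodic x funpow_mult_fixed)
    moreover have "real n * T
        = real j * birkhoff_sum l h x + real r * T"
      using \<open>1 \<le> l\<close> by (simp add: T_def n field_simps)
    moreover have "\<bar>birkhoff_sum r h x\<bar> \<le> B * real r"
      by (rule abs_birkhoff_sum_le[OF B x(1)])
    moreover have "B * real r \<le> B * real l"
      using \<open>r < l\<close> \<open>0 \<le> B\<close> by (intro mult_left_mono) auto
    moreover have "\<bar>T\<bar> \<le> B"
      using abs_birkhoff_sum_le[OF B x(1), where n=l] \<open>1 \<le> l\<close> by (simp add: T_def divide_simps)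
    then have "real r * \<bar>T\<bar> \<le> real l * B"
      using \<open>r < l\<close> \<open>0 \<le> B\<close> by (intro mult_mono) auto
    then have "\<bar>real r * T\<bar> \<le> B * real l"
      by (simp add: abs_mult mult.commute)
    ultimately show ?thesis by linarith
  qed
  then show thesis unfolding T_def by (rule that)
qed

end

section \<open>Integral growth and growth at periodic points\<close>

context almost_subadditive_potential
begin

text \<open>Invariance makes the integral of \<open>S_n h\<close> equal to \<open>n\<close> times
  that of \<open>h\<close>, and the uniform bound integrates unchanged against a probability
  measure.\<close>

lemma growth_within_imp_same_asymptotic_integrals:
  assumes h: "continuous_on X h" and growth: "\<And>\<epsilon>. 0 < \<epsilon> \<Longrightarrow> growth_within X f h \<epsilon>"
  shows "same_asymptotic_integrals X f h"
  unfolding same_asymptotic_integrals_def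
proof (intro ballI conjI)
  fix \<mu> assume \<mu>: "\<mu> \<in> invariant_measures X"
  interpret prob_space \<mu> by (rule invariant_prob_space) fact
  have "(\<lambda>n. 1 / real n * ((\<integral>x. ln (f n x) \<partial>\<mu>) - real n * (\<integral>x. h x \<partial>\<mu>))) \<longlonglongrightarrow> 0"
  proof (rule eventually_le_imp_tendsto_zero)
    fix \<epsilon> :: real assume "0 < \<epsilon>"
    from growth[OF this, unfolded growth_within_def] eventually_ge_at_top[of 1]
    show "\<forall>\<^sub>F n in sequentially. \<bar>(\<integral>x. ln (f n x) \<partial>\<mu>) - real n * (\<integral>x. h x \<partial>\<mu>)\<bar> \<le> \<epsilon> * real n"
    proof eventually_elim
      case (elim n)
      let ?g = "\<lambda>x. ln (f n x) - birkhoff_sum n h x"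
      note int = integrable_invariant[OF \<mu> continuous_ln_f[OF elim(2)]]
        integrable_invariant[OF \<mu> continuous_on_birkhoff_sum[OF h, of n]]
      have "(\<integral>x. ?g x \<partial>\<mu>) = (\<integral>x. ln (f n x) \<partial>\<mu>) - real n * (\<integral>x. h x \<partial>\<mu>)"
        using Bochner_Integration.integral_diff[OF int]
        by (simp add: integral_birkhoff_sum[OF \<mu> h])
      moreover have "(\<integral>x. ?g x \<partial>\<mu>) \<le> \<epsilon> * real n"
        using elim(1) space_invariant[OF \<mu>] abs_le_D1
        by (intro integral_le_const Bochner_Integration.integrable_diff int AE_I2) auto
      moreover have "- (\<epsilon> * real n) \<le> (\<integral>x. ?g x \<partial>\<mu>)"
        using elim(1) space_invariant[OF \<mu>]
        by (intro integral_ge_const Bochner_Integration.integrable_diff int AE_I2)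
           (auto simp: abs_le_iff)
      ultimately show ?case by linarith
    qed
  qed
  then have "(\<lambda>n. 1 / real n * (\<integral>x. ln (f n x) \<partial>\<mu>)) \<longlonglongrightarrow> (\<integral>x. h x \<partial>\<mu>)"
    by (simp only: tendsto_mean_diff_iff)
  then show "(\<lambda>n. ereal (1 / real n * (\<integral>x. ln (f n x) \<partial>\<mu>))) \<longlonglongrightarrow> ereal (\<integral>x. h x \<partial>\<mu>)"
    by (rule tendsto_ereal)
qed simp

text \<open>By almost subadditivity, \<open>ln f\<^sub>n\<close> at a point of period \<open>l\<close> is squeezed, up to a constant,
  between the averages of \<open>ln f\<^sub>n\<^sub>+\<^sub>l\<close> and \<open>ln f\<^sub>n\<^sub>-\<^sub>l\<close> over its orbit, and these are integrals
  with respect to the orbit measure.\<close>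

lemma same_asymptotic_integrals_imp_birkhoff_asymptotic_at:
  assumes h: "continuous_on X h" and integrals: "same_asymptotic_integrals X f h"
    and x: "x \<in> X" "periodic_point x"
  shows "birkhoff_asymptotic_at f h x"
proof -
  obtain l where "1 \<le> l" and period: "(shift_map ^^ l) x = x"
    using x(2) by (auto simp: periodic_point_def)
  define A where "A = (\<lambda>n. (\<Sum>i<l. ln (f n ((shift_map ^^ i) x))) / real l)"
  define H where "H = birkhoff_sum l h x / real l"
  obtain \<mu> where \<mu>: "\<mu> \<in> invariant_measures X"
    and int: "\<And>g :: (nat \<Rightarrow> nat) \<Rightarrow> real. continuous_on X g \<Longrightarrow>
      (\<integral>y. g y \<partial>\<mu>) = (\<Sum>i<l. g ((shift_map ^^ i) x)) / real l"
    using periodic_orbit_measure[OF x(1) period \<open>1 \<le> l\<close>] by blast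
  have int_h: "(\<integral>y. h y \<partial>\<mu>) = H"
    using int[OF h] by (simp add: H_def birkhoff_sum_def)
  have int_f: "(\<integral>y. ln (f n y) \<partial>\<mu>) = A n" if "1 \<le> n" for n
    using int[OF continuous_ln_f[OF that]] by (simp add: A_def)
  have "(\<lambda>n. 1 / real n * (\<integral>y. ln (f n y) \<partial>\<mu>)) \<longlonglongrightarrow> H"
    using integrals \<mu> unfolding same_asymptotic_integrals_def lim_ereal int_h[symmetric] by blast
  then have "(\<lambda>n. 1 / real n * A n) \<longlonglongrightarrow> H"
    by (rule Lim_transform_eventually[OF _ eventually_mono[OF eventually_ge_at_top[of 1]]])
       (simp add: int_f)
  then have A_lim: "(\<lambda>n. 1 / real n * (A n - real n * H)) \<longlonglongrightarrow> 0"
    by (simp only: tendsto_mean_diff_iff)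
  obtain D where D: "\<And>n. \<bar>birkhoff_sum n h x - real n * H\<bar> \<le> D"
    using birkhoff_sum_periodic_average[OF h x(1) period \<open>1 \<le> l\<close>] unfolding H_def by blast
  obtain K where "0 \<le> K" and
    K: "\<And>n j x. \<lbrakk>1 \<le> n; j \<le> l; x \<in> X\<rbrakk> \<Longrightarrow> ln (f (n + j) x) \<le> K + ln (f n x)"
      "\<And>n j x. \<lbrakk>1 \<le> n; j \<le> l; x \<in> X\<rbrakk> \<Longrightarrow> ln (f (j + n) x) \<le> K + ln (f n ((shift_map ^^ j) x))"
    using ln_f_trim by metis
  \<comment> \<open>Write \<open>n + l\<close> as \<open>i + n + (l - i)\<close> and trim both ends;
    what is left is \<open>f n\<close> at the \<open>i\<close>-th orbit point. Each trimming costs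
    one \<open>K\<close>, and averaging over \<open>i\<close> produces \<open>A n\<close>.\<close>
  have upper: "ln (f (n + l) x) \<le> 2 * K + A n" if "1 \<le> n" for n
  proof -
    have "ln (f (n + l) x) \<le> 2 * K + ln (f n ((shift_map ^^ i) x))" if "i < l" for i
    proof -
      have "i + (n + (l - i)) = n + l" using that by simp
      then have "ln (f (n + l) x) \<le> K + ln (f (n + (l - i)) ((shift_map ^^ i) x))"
        using K(2)[of "n + (l - i)" i x] that \<open>1 \<le> n\<close> x(1) by simp
      also have "ln (f (n + (l - i)) ((shift_map ^^ i) x)) \<le> K + ln (f n ((shift_map ^^ i) x))"
        using \<open>1 \<le> n\<close> x(1) by (intro K) (auto simp: funpow_shift_closed)
      finally show ?thesis by simp
    qed
    then have "(\<Sum>i<l. ln (f (n + l) x)) \<le> (\<Sum>i<l. 2 * K + ln (f n ((shift_map ^^ i) x)))"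
      by (intro sum_mono) auto
    then show ?thesis
      using \<open>1 \<le> l\<close> by (simp add: A_def sum.distrib field_simps)
  qed
  \<comment> \<open>Conversely, from the \<open>i\<close>-th orbit point \<open>l - i\<close> steps
    lead back to \<open>x\<close>. Trimming these in front and \<open>i\<close> steps at the end
    leaves \<open>f n x\<close>.\<close>
  have lower: "A (n + l) \<le> 2 * K + ln (f n x)" if "1 \<le> n" for n
  proof -
    have "ln (f (n + l) ((shift_map ^^ i) x)) \<le> 2 * K + ln (f n x)" if "i < l" for i
    proof -
      have "(l - i) + (n + i) = n + l" using that by simp
      moreover have "(shift_map ^^ (l - i)) ((shift_map ^^ i) x) = x"
        using that period by (simp add: funpow_add[THEN fun_cong, unfolded o_apply, symmetric])
      ultimately have "ln (f (n + l) ((shift_map ^^ i) x)) \<le> K + ln (f (n + i) x)"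
        using K(2)[of "n + i" "l - i" "(shift_map ^^ i) x"] \<open>1 \<le> n\<close> x(1)
        by (simp add: funpow_shift_closed add.commute)
      also have "ln (f (n + i) x) \<le> K + ln (f n x)"
        using that \<open>1 \<le> n\<close> x(1) by (intro K) auto
      finally show ?thesis by simp
    qed
    then have "(\<Sum>i<l. ln (f (n + l) ((shift_map ^^ i) x))) \<le> (\<Sum>i<l. 2 * K + ln (f n x))"
      by (intro sum_mono) auto
    then show ?thesis
      using \<open>1 \<le> l\<close> by (simp add: A_def field_simps)
  qed
  show ?thesis
    unfolding birkhoff_asymptotic_at_iff[OF x(1)]
  proof (rule eventually_le_imp_tendsto_zero)
    fix \<epsilon> :: real assume "0 < \<epsilon>"
    then have "\<forall>\<^sub>F n in sequentially. \<bar>A n - real n * H\<bar> \<le> \<epsilon> / 2 * real n"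
      by (intro tendsto_zero_imp_eventually_le[OF A_lim]) simp
    then obtain N where N: "\<And>n. n \<ge> N \<Longrightarrow> \<bar>A n - real n * H\<bar> \<le> \<epsilon> / 2 * real n"
      unfolding eventually_sequentially by blast
    \<comment> \<open>The constants are the two trimmings, the periodic fluctuation \<open>D\<close>
      of the Birkhoff sum, and the cost of comparing at times \<open>n - l\<close> and
      \<open>n + l\<close> instead of \<open>n\<close>: \<open>l\<close> times the mean, and the
      error rate over \<open>l\<close> more steps.\<close>
    have "\<forall>\<^sub>F n in sequentially. 2 * K + D + real l * \<bar>H\<bar> + \<epsilon> / 2 * real l \<le> \<epsilon> / 2 * real n"
      using \<open>0 < \<epsilon>\<close> by (intro eventually_const_le_mult) simp
    then show "\<forall>\<^sub>F n in sequentially. \<bar>ln (f n x) - birkhoff_sum n h x\<bar> \<le> \<epsilon> * real n"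
      using eventually_ge_at_top[of "N + l + 1"]
    proof eventually_elim
      case (elim n)
      define m where "m = n - l"
      have m: "n = m + l" "1 \<le> m" "N \<le> m" using elim(2) by (auto simp: m_def)
      have H: "\<bar>real l * H\<bar> = real l * \<bar>H\<bar>" by (simp add: abs_mult)
      have "0 \<le> \<epsilon> / 2 * real l" using \<open>0 < \<epsilon>\<close> by simp
      moreover have "real n * H = real m * H + real l * H" "real (n + l) * H = real n * H + real l * H"
        "\<epsilon> / 2 * real n = \<epsilon> / 2 * real m + \<epsilon> / 2 * real l"
        "\<epsilon> / 2 * real (n + l) = \<epsilon> / 2 * real n + \<epsilon> / 2 * real l"
        by (simp_all add: m field_simps)
      moreover have "\<bar>A m - real m * H\<bar> \<le> \<epsilon> / 2 * real m" by (rule N) fact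
      moreover have "\<bar>A (n + l) - real (n + l) * H\<bar> \<le> \<epsilon> / 2 * real (n + l)"
        using elim(2) by (intro N) simp
      moreover have "ln (f n x) \<le> 2 * K + A m" using upper[OF m(2)] by (simp add: m)
      moreover have "A (n + l) \<le> 2 * K + ln (f n x)" using elim(2) by (intro lower) simp
      moreover have "\<epsilon> / 2 * real n + \<epsilon> / 2 * real n = \<epsilon> * real n" by simp
      ultimately show ?case using D[of n] H elim(1) by linarith
    qed
  qed
qed

end

section \<open>Irreducible shifts of finite type\<close>

lemma all_wordsE:
  assumes "v \<in> all_words X" "v \<noteq> []"
  obtains x i where "x \<in> X" "\<forall>j<length v. x (i + j) = v ! j"
  using assms by (auto simp: all_words_def words_of_length_def appears_in_def split: if_splits)

text \<open>To close up \<open>u\<close> it suffices to connect its last letter to its first.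
  Irreducibility supplies a connecting word for each pair of letters, and finiteness of the alphabet
  bounds the lengths. The periodic point lies in \<open>X\<close> because every two consecutive
  letters of it occur in some point of \<open>X\<close>.\<close>

lemma irreducible_SFT_closing_word:
  assumes sft: "one_step_SFT X" and irred: "irreducible_shift X"
  obtains k where "1 \<le> k" "\<And>n u. \<lbrakk>1 \<le> n; u \<in> words_of_length n X\<rbrakk> \<Longrightarrow>
    \<exists>q\<le>k. \<exists>w\<in>words_of_length q X. periodic_word (u @ w) \<in> X"
proof -
  obtain K F where F: "F \<subseteq> {u \<in> lists {1..K}. length u \<le> 2}"
    and X: "X = {x \<in> full_shift K. \<forall>u\<in>F. \<not> appears_in u x}"
    using sft by (auto simp: one_step_SFT_def)
  have X_range: "x i \<in> {1..K}" if "x \<in> X" for x i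
    using that X by (auto simp: full_shift_def)
  have letter: "[a] \<in> all_words X" if "x \<in> X" "x i = a" for x i a
    using that unfolding all_words_def words_of_length_def appears_in_def
    by (auto intro!: exI[of _ 1] bexI[of _ x] exI[of _ i])
  have "\<exists>w. [a] \<in> all_words X \<and> [b] \<in> all_words X \<longrightarrow> w \<in> all_words X \<and> [a] @ w @ [b] \<in> all_words X" for a b
    using irred unfolding irreducible_shift_def by blast
  then obtain W where W: "\<And>a b. \<lbrakk>[a] \<in> all_words X; [b] \<in> all_words X\<rbrakk> \<Longrightarrow>
      W a b \<in> all_words X \<and> [a] @ W a b @ [b] \<in> all_words X"
    by metis
  \<comment> \<open>The sum dominates each connecting length, and \<open>Suc\<close> makes
    \<open>k\<close> positive.\<close>
  define k where "k = Suc (\<Sum>(a, b)\<in>{1..K} \<times> {1..K}. length (W a b))"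
  \<comment> \<open>Membership is a matter of two-letter windows: a forbidden block has length at
    most 2, so if it appeared in \<open>z\<close> it would already appear in the point of
    \<open>X\<close> that shares the window.\<close>
  have X_I: "z \<in> X" if step: "\<And>i. \<exists>x\<in>X. \<exists>m. x m = z i \<and> x (Suc m) = z (Suc i)" for z
  proof -
    have "z i \<in> {1..K}" for i
    proof -
      obtain x m where "x \<in> X" "x m = z i" using step by blast
      then show ?thesis using X_range[of x m] by simp
    qed
    then have "z \<in> full_shift K" by (simp add: full_shift_def)
    moreover have "\<not> appears_in s z" if "s \<in> F" for s
    proof
      assume "appears_in s z"
      then obtain i where i: "\<And>j. j < length s \<Longrightarrow> z (i + j) = s ! j"
        by (auto simp: appears_in_def)
      obtain x m where x: "x \<in> X" "x m = z i" "x (Suc m) = z (Suc i)"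
        using step by blast
      have "x (m + j) = s ! j" if "j < length s" for j
      proof -
        have "j = 0 \<or> j = 1" using that F \<open>s \<in> F\<close> by fastforce
        then show ?thesis using i[OF that] x by auto
      qed
      then have "appears_in s x" by (auto simp: appears_in_def)
      then show False using x(1) \<open>s \<in> F\<close> X by blast
    qed
    ultimately show ?thesis by (simp add: X)
  qed
  show thesis
  proof
    show "1 \<le> k" by (simp add: k_def)
    fix n u assume "1 \<le> n" and u: "u \<in> words_of_length n X"
    then have len: "length u = n" and "u \<noteq> []"
      by (auto simp: words_of_length_def split: if_splits)
    have "u \<in> all_words X" using u by (auto simp: all_words_def)
    then obtain x i where x: "x \<in> X" "\<And>j. j < length u \<Longrightarrow> x (i + j) = u ! j"
      using \<open>u \<noteq> []\<close> all_wordsE[of u X] by metis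
    define a b where "a = last u" "b = hd u"
    have a: "x (i + (length u - 1)) = a" and b: "x (i + 0) = b"
      using x(2)[of 0] x(2)[of "length u - 1"] \<open>u \<noteq> []\<close> unfolding a_b_def
    by (simp_all add: last_conv_nth hd_conv_nth)
    define w where "w = W a b"
    define v where "v = [a] @ w @ [b]"
    have "w \<in> all_words X" "v \<in> all_words X"
      using W[OF letter[OF x(1) a] letter[OF x(1) b]] by (simp_all add: w_def v_def)
    then have w: "w \<in> words_of_length (length w) X"
      by (auto simp: all_words_def words_of_length_def split: if_splits)
    have "(a, b) \<in> {1..K} \<times> {1..K}"
      using X_range[OF x(1)] a b by blast
    then have "(case (a, b) of (a, b) \<Rightarrow> length (W a b))
        \<le> (\<Sum>(a, b)\<in>{1..K} \<times> {1..K}. length (W a b))"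
      by (intro member_le_sum) auto
    then have "length w \<le> k" by (simp add: w_def k_def)
    obtain y m where y: "y \<in> X" "\<And>j. j < length v \<Longrightarrow> y (m + j) = v ! j"
      using \<open>v \<in> all_words X\<close> all_wordsE[of v X] unfolding v_def by (metis append_is_Nil_conv not_Cons_self2)
    \<comment> \<open>One period followed by the first letter of the next. Since \<open>u\<close>
      and \<open>v\<close> overlap in the letter \<open>a\<close>, every two-letter window of
      \<open>t\<close> lies inside \<open>u\<close>, which occurs in \<open>x\<close>, or inside
      \<open>v\<close>, which occurs in \<open>y\<close>.\<close>
    define t where "t = u @ w @ [b]"
    have t: "t = butlast u @ v"
      using \<open>u \<noteq> []\<close> by (simp add: t_def v_def a_b_def)
    have "periodic_word (u @ w) \<in> X"
    proof (rule X_I)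
      fix l
      define p where "p = length (u @ w)"
      define r where "r = l mod p"
      have "0 < p" using \<open>u \<noteq> []\<close> by (simp add: p_def)
      then have "r < p" by (simp add: r_def)
      have z0: "periodic_word (u @ w) l = t ! r"
        using \<open>r < p\<close> unfolding periodic_word_def t_def r_def p_def
        by (metis append.assoc nth_append)
      \<comment> \<open>At the end of a period the next letter is again the first letter of
        \<open>u\<close>, which is the appended \<open>b\<close>.\<close>
      have z1: "periodic_word (u @ w) (Suc l) = t ! Suc r"
      proof (cases "Suc r = p")
        case True
        then have "Suc l mod p = 0" by (simp add: r_def mod_Suc)
        then show ?thesis
          using True \<open>u \<noteq> []\<close> unfolding periodic_word_def t_def p_def[symmetric]
          by (simp add: p_def nth_append a_b_def hd_conv_nth)
      next
        case False
        then have "Suc l mod p = Suc r" by (simp add: r_def mod_Suc)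
        then show ?thesis
          using False \<open>r < p\<close> nth_append[of "u @ w" "[b]" "Suc r"]
          unfolding periodic_word_def t_def p_def[symmetric] by simp
      qed
      show "\<exists>x\<in>X. \<exists>m. x m = periodic_word (u @ w) l \<and> x (Suc m) = periodic_word (u @ w) (Suc l)"
      proof (cases "Suc r < length u")
        case True
        then have "x (i + r) = t ! r" "x (Suc (i + r)) = t ! Suc r"
          using x(2)[of r] x(2)[of "Suc r"] by (simp_all add: t_def nth_append)
        then show ?thesis unfolding z0 z1 using x(1) by blast
      next
        case False
        \<comment> \<open>The offset is \<open>length u - 1\<close> because \<open>v\<close> starts
          at the last letter of \<open>u\<close>.\<close>
        define j where "j = r - (length u - 1)"
        have r: "r = length (butlast u) + j" using False by (simp add: j_def)
        have "Suc j < length v"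
          using \<open>r < p\<close> False \<open>u \<noteq> []\<close> by (cases u) (auto simp: v_def p_def j_def)
        then have "y (m + j) = t ! r" "y (Suc (m + j)) = t ! Suc r"
          using y(2)[of j] y(2)[of "Suc j"] unfolding t r
          by (simp_all only: nth_append_length_plus add_Suc_right[symmetric] Suc_lessD)
        then show ?thesis unfolding z0 z1 using y(1) by blast
      qed
    qed
    then show "\<exists>q\<le>k. \<exists>w\<in>words_of_length q X. periodic_word (u @ w) \<in> X"
      using w \<open>length w \<le> k\<close> by blast
  qed
qed

section \<open>Condition (ii) from uniform growth\<close>

context almost_subadditive_potential
begin

text \<open>Any closing word of bounded length will do: over one period the Birkhoff sum of
  \<open>h\<close> at \<open>z\<close> is close to \<open>ln (f n z)\<close>, hence to the logarithm
  of the supremum on the cylinder, and over \<open>j\<close> periods it is multiplied by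
  \<open>j\<close>. All errors go into the exponential factor, so \<open>c = 1\<close> and
  \<open>M n = 1\<close> suffice.\<close>

lemma growth_within_imp_periodic_lower_bound:
  assumes sft: "one_step_SFT X" and irred: "irreducible_shift X"
    and h: "continuous_on X h" and growth: "\<And>\<epsilon>. 0 < \<epsilon> \<Longrightarrow> growth_within X f h \<epsilon>"
  shows "periodic_lower_bound X f"
proof -
  obtain k where "1 \<le> k" and k: "\<And>n u. \<lbrakk>1 \<le> n; u \<in> words_of_length n X\<rbrakk> \<Longrightarrow>
      \<exists>q\<le>k. \<exists>w\<in>words_of_length q X. periodic_word (u @ w) \<in> X"
    using irreducible_SFT_closing_word[OF sft irred] by blast
  obtain B where "0 \<le> B" and B: "\<And>x. x \<in> X \<Longrightarrow> \<bar>h x\<bar> \<le> B"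
    using bounded_abs[OF h] by blast
  have lower: "\<exists>N\<ge>1. \<forall>n\<ge>N. \<forall>u\<in>words_of_length n X. \<exists>q\<le>k. \<exists>w\<in>words_of_length q X.
      periodic_word (u @ w) \<in> X \<and>
      (\<forall>j\<ge>1. (1 * exp (- 1 * real n * \<epsilon>)) ^ j * (SUP x\<in>cylinder X u. f n x) ^ j
        \<le> f (j * (n + q)) (periodic_word (u @ w)))"
    if "0 < \<epsilon>" for \<epsilon>
  proof -
    \<comment> \<open>The loss \<open>\<epsilon> * n\<close> is spent in four equal shares: the
      variation of \<open>f n\<close> on the cylinder, the growth error at time \<open>n\<close>,
      the growth error per period at time \<open>j * p\<close>, and the contribution of the
      \<open>q \<le> k\<close> extra steps.\<close>
    define \<delta> where "\<delta> = \<epsilon> / 4"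
    have "0 < \<delta>" using that by (simp add: \<delta>_def)
    obtain N1 where N1: "\<And>n x. \<lbrakk>n \<ge> N1; x \<in> X\<rbrakk> \<Longrightarrow> \<bar>ln (f n x) - birkhoff_sum n h x\<bar> \<le> \<delta> * real n"
      using growth[OF \<open>0 < \<delta>\<close>] unfolding growth_within_def eventually_sequentially by blast
    obtain N2 where N2: "\<And>n x y. \<lbrakk>n \<ge> N2; x \<in> X; y \<in> X; \<forall>i<n. x i = y i\<rbrakk> \<Longrightarrow>
        ln (f n x) - ln (f n y) \<le> \<delta> * real n"
      using ln_f_variation[OF \<open>0 < \<delta>\<close>] unfolding eventually_sequentially by blast
    obtain N3 where N3: "\<And>n. n \<ge> N3 \<Longrightarrow> B * real k + \<delta> * real k \<le> \<delta> * real n"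
      using eventually_const_le_mult[OF \<open>0 < \<delta>\<close>] unfolding eventually_sequentially by blast
    show ?thesis
    proof (rule exI[of _ "Max {1, N1, N2, N3}"], intro conjI allI impI ballI)
      show "1 \<le> Max {1, N1, N2, N3}" by simp
      fix n u assume "Max {1, N1, N2, N3} \<le> n" and u: "u \<in> words_of_length n X"
      then have n: "1 \<le> n" "N1 \<le> n" "N2 \<le> n" "N3 \<le> n" by auto
      obtain q w where "q \<le> k" and w: "w \<in> words_of_length q X" and zX: "periodic_word (u @ w) \<in> X"
        using k[OF n(1) u] by blast
      define z where "z = periodic_word (u @ w)"
      define p where "p = n + q"
      have "z \<in> X" using zX by (simp add: z_def)
      obtain x0 where len: "length u = n" and "x0 \<in> cylinder X u"
        using words_of_lengthE[OF u n(1)] by blast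
      moreover have "length w = q"
        using w by (auto simp: words_of_length_def split: if_splits)
      ultimately have "length (u @ w) = p" by (simp add: p_def)
      then have period: "(shift_map ^^ p) z = z"
        using periodic_word_period[of "u @ w"] by (simp add: z_def)
      define s where "s = exp (ln (f n z) + \<delta> * real n)"
      have "f n x \<le> s" if "x \<in> cylinder X u" for x
      proof -
        have "x \<in> X" "\<forall>i<n. x i = z i"
          using that len periodic_word_prefix[of _ u w] by (auto simp: cylinder_def z_def)
        then have "ln (f n x) \<le> ln (f n z) + \<delta> * real n"
          using N2[OF n(3) _ \<open>z \<in> X\<close>] by force
        then show ?thesis
          using f_pos[OF n(1) \<open>x \<in> X\<close>] unfolding s_def by (metis exp_le_cancel_iff exp_ln)
      qed
      moreover have "cylinder X u \<noteq> {}" using \<open>x0 \<in> cylinder X u\<close> by blast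
      ultimately have Sup_le: "(SUP x\<in>cylinder X u. f n x) \<le> s"
        by (intro cSUP_least) auto
      have "0 < f n x0" "f n x0 \<le> (SUP x\<in>cylinder X u. f n x)"
        using \<open>x0 \<in> cylinder X u\<close> f_pos[OF n(1), of x0] \<open>\<And>x. x \<in> cylinder X u \<Longrightarrow> f n x \<le> s\<close>
        by (auto simp: cylinder_def intro!: cSUP_upper bdd_aboveI2[of _ _ s])
      then have Sup_nonneg: "0 \<le> (SUP x\<in>cylinder X u. f n x)" by linarith
      have "(1 * exp (- 1 * real n * \<epsilon>)) ^ j * (SUP x\<in>cylinder X u. f n x) ^ j \<le> f (j * p) z"
        if "1 \<le> j" for j
      proof -
        have "n \<le> 1 * p" by (simp add: p_def)
        also have "\<dots> \<le> j * p"
          using that by (intro mult_right_mono) auto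
        finally have "N1 \<le> j * p" "1 \<le> j * p"
          using order_trans[OF n(2)] order_trans[OF n(1)] by blast+
        have "\<bar>birkhoff_sum q h ((shift_map ^^ n) z)\<bar> \<le> B * real q"
          by (rule abs_birkhoff_sum_le[OF B]) (auto intro: funpow_shift_closed \<open>z \<in> X\<close>)
        moreover have "B * real q \<le> B * real k"
          using \<open>q \<le> k\<close> \<open>0 \<le> B\<close> by (intro mult_left_mono) auto
        moreover have "\<bar>ln (f n z) - birkhoff_sum n h z\<bar> \<le> \<delta> * real n"
          by (rule N1[OF n(2) \<open>z \<in> X\<close>])
        moreover have "\<delta> * real p \<le> \<delta> * real n + \<delta> * real k"
          using \<open>q \<le> k\<close> \<open>0 < \<delta>\<close> by (simp add: p_def ring_distribs)
        moreover have "real n * \<epsilon> = 4 * (\<delta> * real n)" by (simp add: \<delta>_def)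
        moreover note N3[OF n(4)] birkhoff_sum_add[of n q h z, folded p_def]
        ultimately have "ln (f n z) + \<delta> * real n - real n * \<epsilon> \<le> birkhoff_sum p h z - \<delta> * real p"
          by linarith
        then have "real j * (ln (f n z) + \<delta> * real n - real n * \<epsilon>)
            \<le> real j * (birkhoff_sum p h z - \<delta> * real p)"
          by (intro mult_left_mono) auto
        \<comment> \<open>Both the Birkhoff sum and the permitted error at time \<open>j * p\<close>
          are exactly \<open>j\<close> times their values at \<open>p\<close>. As
          \<open>j * p \<ge> n\<close>, a single threshold serves all \<open>j\<close>.\<close>
        also have "\<dots> = birkhoff_sum (j * p) h z - \<delta> * real (j * p)"
          by (simp add: birkhoff_sum_periodic[OF period] algebra_simps)
        also have "\<dots> \<le> ln (f (j * p) z)"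
          using N1[OF \<open>N1 \<le> j * p\<close> \<open>z \<in> X\<close>] by linarith
        finally have "exp (real j * (ln (f n z) + \<delta> * real n - real n * \<epsilon>)) \<le> f (j * p) z"
          using f_pos[OF \<open>1 \<le> j * p\<close> \<open>z \<in> X\<close>] by (metis exp_le_cancel_iff exp_ln)
        moreover have "exp (real j * (ln (f n z) + \<delta> * real n - real n * \<epsilon>))
            = (1 * exp (- 1 * real n * \<epsilon>)) ^ j * s ^ j"
          by (simp add: s_def exp_of_nat_mult[symmetric] exp_add[symmetric] algebra_simps)
        moreover have "(1 * exp (- 1 * real n * \<epsilon>)) ^ j * (SUP x\<in>cylinder X u. f n x) ^ j
            \<le> (1 * exp (- 1 * real n * \<epsilon>)) ^ j * s ^ j"
          by (intro mult_left_mono power_mono Sup_le Sup_nonneg) auto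
        ultimately show ?thesis by linarith
      qed
      then show "\<exists>q\<le>k. \<exists>w\<in>words_of_length q X. periodic_word (u @ w) \<in> X \<and>
          (\<forall>j\<ge>1. (1 * exp (- 1 * real n * \<epsilon>)) ^ j * (SUP x\<in>cylinder X u. f n x) ^ j
            \<le> f (j * (n + q)) (periodic_word (u @ w)))"
        using \<open>q \<le> k\<close> w zX unfolding z_def p_def by blast
    qed
  qed
  show ?thesis
    unfolding periodic_lower_bound_def
    using \<open>1 \<le> k\<close> lower
    by (intro exI[of _ k] exI[of _ "1::real"] exI[of _ "\<lambda>_. 1::real"] conjI) simp_all
qed

end

theorem theorem4p2:
  shows
    "(\<forall>(X :: (nat \<Rightarrow> nat) set) (f :: nat \<Rightarrow> (nat \<Rightarrow> nat) \<Rightarrow> real).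
        one_step_SFT X \<and> irreducible_shift X \<and>
        potential_seq X f \<and> tempered_variation X f \<and>
        (\<exists>C\<ge>0. subadditive_seq X (\<lambda>n x. exp C * f n x)) \<longrightarrow>
        (asymptotically_additive X f \<longleftrightarrow>
          (\<exists>h. continuous_on X h \<and>
            (\<forall>x\<in>X. periodic_point x \<longrightarrow> birkhoff_asymptotic_at f h x)) \<and>
          periodic_lower_bound X f))
     \<and>
     (\<forall>(X :: (nat \<Rightarrow> nat) set) (f :: nat \<Rightarrow> (nat \<Rightarrow> nat) \<Rightarrow> real)
        (h :: (nat \<Rightarrow> nat) \<Rightarrow> real).
        is_subshift X \<and>
        potential_seq X f \<and> tempered_variation X f \<and>
        (\<exists>C\<ge>0. subadditive_seq X (\<lambda>n x. exp C * f n x)) \<and>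
        periodic_lower_bound X f \<and> continuous_on X h \<longrightarrow>
        (let a = asymptotically_additive X f \<and> birkhoff_asymptotic_uniformly X f h;
             b = same_asymptotic_integrals X f h;
             c = (\<forall>x\<in>X. periodic_point x \<longrightarrow> birkhoff_asymptotic_at f h x);
             d = (\<forall>x\<in>X. birkhoff_asymptotic_at f h x)
         in (a \<longleftrightarrow> b) \<and> (b \<longleftrightarrow> c) \<and> (c \<longleftrightarrow> d)))"
proof (rule conjI; intro allI impI; (elim conjE exE)?)
  fix X :: "(nat \<Rightarrow> nat) set" and f :: "nat \<Rightarrow> (nat \<Rightarrow> nat) \<Rightarrow> real" and C :: real
  assume sft: "one_step_SFT X" and irred: "irreducible_shift X"
    and "potential_seq X f" "tempered_variation X f"
    and "0 \<le> C" "subadditive_seq X (\<lambda>n x. exp C * f n x)"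
  then interpret almost_subadditive_potential X f C
    by unfold_locales (auto intro: one_step_SFT_imp_is_subshift)
  show "asymptotically_additive X f \<longleftrightarrow>
      (\<exists>h. continuous_on X h \<and>
        (\<forall>x\<in>X. periodic_point x \<longrightarrow> birkhoff_asymptotic_at f h x)) \<and>
      periodic_lower_bound X f"
  proof
    assume "asymptotically_additive X f"
    then obtain h where "continuous_on X h" "\<And>\<epsilon>. 0 < \<epsilon> \<Longrightarrow> growth_within X f h \<epsilon>"
      using asymptotically_additive_imp_growth_within by blast
    then show "(\<exists>h. continuous_on X h \<and>
        (\<forall>x\<in>X. periodic_point x \<longrightarrow> birkhoff_asymptotic_at f h x)) \<and> periodic_lower_bound X f"
      using growth_within_imp_birkhoff_asymptotic_at
        growth_within_imp_periodic_lower_bound[OF sft irred] by blast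
  next
    assume "(\<exists>h. continuous_on X h \<and>
        (\<forall>x\<in>X. periodic_point x \<longrightarrow> birkhoff_asymptotic_at f h x)) \<and> periodic_lower_bound X f"
    then show "asymptotically_additive X f"
      using growth_within_imp_asymptotically_additive
        birkhoff_asymptotic_periodic_imp_growth_within by blast
  qed
next
  fix X :: "(nat \<Rightarrow> nat) set" and f :: "nat \<Rightarrow> (nat \<Rightarrow> nat) \<Rightarrow> real"
    and h :: "(nat \<Rightarrow> nat) \<Rightarrow> real" and C :: real
  assume "is_subshift X" "potential_seq X f" "tempered_variation X f"
    and "0 \<le> C" "subadditive_seq X (\<lambda>n x. exp C * f n x)"
    and plb: "periodic_lower_bound X f" and h: "continuous_on X h"
  then interpret almost_subadditive_potential X f C
    by unfold_locales
  let ?a = "asymptotically_additive X f \<and> birkhoff_asymptotic_uniformly X f h"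
  let ?b = "same_asymptotic_integrals X f h"
  let ?c = "\<forall>x\<in>X. periodic_point x \<longrightarrow> birkhoff_asymptotic_at f h x"
  let ?d = "\<forall>x\<in>X. birkhoff_asymptotic_at f h x"
  \<comment> \<open>Uniform growth is the hub: it is equivalent to \<open>?a\<close>, which yields
    \<open>?b\<close> and then \<open>?c\<close>; condition (ii) leads from \<open>?c\<close> back
    to uniform growth. Uniform growth also gives \<open>?d\<close>, of which \<open>?c\<close> is
    the restriction to periodic points.\<close>
  have "?a \<longleftrightarrow> (\<forall>\<epsilon>>0. growth_within X f h \<epsilon>)"
    using growth_within_imp_asymptotically_additive[OF h] birkhoff_asymptotic_uniformly_iff[OF h]
    by blast
  moreover from this have "?a \<Longrightarrow> ?b"
    using growth_within_imp_same_asymptotic_integrals[OF h] by blast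
  moreover have "?b \<Longrightarrow> ?c"
    using same_asymptotic_integrals_imp_birkhoff_asymptotic_at[OF h] by blast
  moreover have "?c \<Longrightarrow> \<forall>\<epsilon>>0. growth_within X f h \<epsilon>"
    using birkhoff_asymptotic_periodic_imp_growth_within[OF h plb] by blast
  moreover have "\<forall>\<epsilon>>0. growth_within X f h \<epsilon> \<Longrightarrow> ?d"
    using growth_within_imp_birkhoff_asymptotic_at by blast
  ultimately have "(?a \<longleftrightarrow> ?b) \<and> (?b \<longleftrightarrow> ?c) \<and> (?c \<longleftrightarrow> ?d)"
    by blast
  then show "let a = ?a; b = ?b; c = ?c; d = ?d in (a \<longleftrightarrow> b) \<and> (b \<longleftrightarrow> c) \<and> (c \<longleftrightarrow> d)"
    by (simp only: Let_def)
qed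

end
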